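(* (i) For every language $L\in\mathsf{PSPACE}$ over a finite alphabet $\Gamma$ there exists a fixed finite-size transformer such that PENCIL with this transformer as next-token generator decides $L$ (on nonempty inputs $w\in\Gamma^*$) with maximal context length bounded by a polynomial in $|w|$. (ii) If a language $L$ over a finite alphabet $\Gamma$ is decided (on nonempty inputs) by standard Chain-of-Thought with some polynomial-time computable next-token generator, with maximal context length bounded by a polynomial in $|w|$, then $L\in\mathsf P$.
   Context: **Generation processes.** $\Sigma$ is a finite vocabulary with two disjoint sets of accepting and rejecting tokens $\Sigma_{\mathrm{accept}},\Sigma_{\mathrm{reject}}\subseteq\Sigma$, and $\pi:\Sigma^*\to\Sigma$ is a next-token generator; $f_\pi(y)=(y,\pi(y))$. A word $w=(w_1,\dots,w_n)\in\Gamma^*$ is given as the prompt $(\mathrm{enc}(w_1),\dots,\mathrm{enc}(w_n))$ for a fixed injective map $\mathrm{enc}:\Gamma\to\Sigma$. *Chain-of-Thought* iterates $y_{j+1}=f_\pi(y_j)$ from the prompt $y_0$. *PENCIL* requires $[\mathrm{SEP}],[\mathrm{RETURN}]\in\Sigma$ (not in the image of $\mathrm{enc}$ and neither accepting nor rejecting) and iterates $y_{j+1}=\phi'(f_\pi(y_j))$, where the reduction rule $\phi'$ is: if $y=(\mathbf T,[\mathrm{SEP}],\mathbf T',[\mathrm{RETURN}])$ with $\mathbf T'$ containing neither $[\mathrm{SEP}]$ nor $[\mathrm{RETURN}]$ then $\phi'(y)=\mathbf T'$, otherwise $\phi'(y)=y$. Either process halts as soon as a generated token is in $\Sigma_{\mathrm{accept}}$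 (accept) or $\Sigma_{\mathrm{reject}}$ (reject). The process decides $L$ if on every nonempty $w\in\Gamma^*$ it halts and accepts exactly when $w\in L$. The maximal context length is the maximum length of $y_0$ and of all sequences $f_\pi(y_j)$ produced before halting. In (ii), $\pi$ is computable in time polynomial in the length of its input sequence. **Transformer (for (i)).** Sequences are nonempty. For $v\in\mathbb R^m$, $\mathrm{hardmax}(v)$ is the uniform probability vector on $\arg\max_j v_j$. A transformer with parameters $d,d_{SA},d_{FF},H,L\in\mathbb N^+$ and real weights acts on $x\in\Sigma^n$ by: $h^{(0)}_i=\theta_{TE}(x_i)+\theta_{PE}\cdot i\in\mathbb R^d$ with $\theta_{TE}:\Sigma\to\mathbb R^d$, $\theta_{PE}\in\mathbb R^d$; in each layer $\ell=1,\dots,L$ (own weights), $u_i=h_i^{(\ell-1)}+\sum_{r=1}^H (W_O^r)^\top\sum_{j\le i}\alpha^r_{ij}W_V^rh_j^{(\ell-1)}$ with $\alpha^r_i=\mathrm{hardmax}\big((W_Q^rh^{(\ell-1)}_i\cdot W_K^rh^{(\ell-1)}_j)_{j\le i}\big)$, $W_Q^r,W_K^r,W_V^r,W_O^r\in\mathbb R^{d_{SA}\times d}$, and $h_i^{(\ell)}=u_i+W_0^\top\big((W_1u_i)\odot\max(W_2u_i,0)\big)$, $W_0,W_1,W_2\in\mathbb R^{d_{FF}\times d}$ ($\odot$ and $\max$ entrywise). The next token is $\pi(x)=\arg\max_{a\in\Sigma}[\theta_{DEC}h_n^{(L)}]_a$, with $\theta_{DEC}\in\mathbb R^{|\Sigma|\times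 d}$, the maximum being required to be unique on the sequences encountered. Computations are over exact reals. *)

theory Defs
  imports
    Complex_Main
    "HOL-Computational_Algebra.Polynomial"
    "Jordan_Normal_Form.Matrix"
begin

section \<open>Turing machines and complexity classes\<close>

text \<open>
  Deterministic machines with one tape that is infinite in both directions. The letters of the
  input alphabet are themselves tape symbols; \<open>Aux\<close> supplies further work symbols.
\<close>

datatype 'a symbol = Blank | Letter 'a | Aux nat

datatype move = MoveLeft | MoveRight | Stay

record 'a tm =
  states :: "nat set"
  symbols :: "'a symbol set"
  start_state :: nat
  accept_state :: nat
  reject_state :: nat
  delta :: "nat \<Rightarrow> 'a symbol \<Rightarrow> nat \<times> 'a symbol \<times> move"

definition turing_machine :: "'a set \<Rightarrow> 'a tm \<Rightarrow> bool" where
  "turing_machine A M \<longleftrightarrow>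
     finite (states M) \<and> finite (symbols M) \<and>
     Blank \<in> symbols M \<and> Letter ` A \<subseteq> symbols M \<and>
     {start_state M, accept_state M, reject_state M} \<subseteq> states M \<and>
     accept_state M \<noteq> reject_state M \<and>
     (\<forall>q \<in> states M - {accept_state M, reject_state M}. \<forall>s \<in> symbols M.
        delta M q s \<in> states M \<times> symbols M \<times> UNIV)"

text \<open>A configuration consists of the state, the tape contents and the head position.\<close>

type_synonym 'a config = "nat \<times> (int \<Rightarrow> 'a symbol) \<times> int"

definition state_of :: "'a config \<Rightarrow> nat" where
  "state_of c = fst c"

definition tape_of :: "'a config \<Rightarrow> int \<Rightarrow> 'a symbol" where
  "tape_of c = fst (snd c)"

definition head_of :: "'a config \<Rightarrow> int" where
  "head_of c = snd (snd c)"

definition initial_config :: "'a tm \<Rightarrow> 'a list \<Rightarrow> 'a config" where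
  "initial_config M w =
     (start_state M,
      (\<lambda>i. if 0 \<le> i \<and> i < int (length w) then Letter (w ! nat i) else Blank),
      0)"

fun move_head :: "move \<Rightarrow> int \<Rightarrow> int" where
  "move_head MoveLeft i = i - 1"
| "move_head MoveRight i = i + 1"
| "move_head Stay i = i"

definition halted :: "'a tm \<Rightarrow> 'a config \<Rightarrow> bool" where
  "halted M c \<longleftrightarrow> state_of c \<in> {accept_state M, reject_state M}"

text \<open>Halting configurations are fixed points of the step function.\<close>

definition tm_step :: "'a tm \<Rightarrow> 'a config \<Rightarrow> 'a config" where
  "tm_step M c =
     (if halted M c then c
      else (case delta M (state_of c) (tape_of c (head_of c)) of
              (q, s, m) \<Rightarrow> (q, (tape_of c)(head_of c := s), move_head m (head_of c))))"

definition config_after :: "'a tm \<Rightarrow> 'a list \<Rightarrow> nat \<Rightarrow> 'a config" where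
  "config_after M w t = (tm_step M ^^ t) (initial_config M w)"

text \<open>
  \<open>decides_at M L w t\<close>: on input \<open>w\<close>, the machine has halted after at most \<open>t\<close> steps
  with the correct verdict.
\<close>

definition decides_at :: "'a tm \<Rightarrow> 'a list set \<Rightarrow> 'a list \<Rightarrow> nat \<Rightarrow> bool" where
  "decides_at M L w t \<longleftrightarrow>
     halted M (config_after M w t) \<and>
     (state_of (config_after M w t) = accept_state M \<longleftrightarrow> w \<in> L)"

definition class_P :: "'a set \<Rightarrow> 'a list set set" where
  "class_P A = {L. L \<subseteq> lists A \<and>
     (\<exists>M (p :: nat poly). turing_machine A M \<and>
        (\<forall>w \<in> lists A. decides_at M L w (poly p (length w))))}"

text \<open>
  Space is the number of tape cells visited by the head. As the machine halts on every input,
  the set of visited cells is finite, so \<open>card\<close> is meaningful.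
\<close>

definition visited_cells :: "'a tm \<Rightarrow> 'a list \<Rightarrow> int set" where
  "visited_cells M w = range (\<lambda>t. head_of (config_after M w t))"

definition class_PSPACE :: "'a set \<Rightarrow> 'a list set set" where
  "class_PSPACE A = {L. L \<subseteq> lists A \<and>
     (\<exists>M (p :: nat poly). turing_machine A M \<and>
        (\<forall>w \<in> lists A. (\<exists>t. decides_at M L w t) \<and>
                       card (visited_cells M w) \<le> poly p (length w)))}"

text \<open>
  The output of a halted machine is the word that starts at cell 0 and extends to the first blank;
  the remaining cells are unconstrained.
\<close>

definition has_output :: "'a config \<Rightarrow> 'a list \<Rightarrow> bool" where
  "has_output c v \<longleftrightarrow>
     (\<forall>i < length v. tape_of c (int i) = Letter (v ! i)) \<and> tape_of c (int (length v)) = Blank"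

definition polytime_computable :: "'a set \<Rightarrow> ('a list \<Rightarrow> 'a list) \<Rightarrow> bool" where
  "polytime_computable A f \<longleftrightarrow>
     (\<exists>M (p :: nat poly). turing_machine A M \<and>
        (\<forall>x \<in> lists A. halted M (config_after M x (poly p (length x))) \<and>
                       has_output (config_after M x (poly p (length x))) (f x)))"

definition polytime_generator :: "'v set \<Rightarrow> ('v list \<Rightarrow> 'v) \<Rightarrow> bool" where
  "polytime_generator V \<pi> \<longleftrightarrow>
     (\<forall>y \<in> lists V. \<pi> y \<in> V) \<and> polytime_computable V (\<lambda>y. [\<pi> y])"


section \<open>Generation processes\<close>

definition vocabulary ::
    "'g set \<Rightarrow> 'v set \<Rightarrow> 'v set \<Rightarrow> 'v set \<Rightarrow> ('g \<Rightarrow> 'v) \<Rightarrow> bool" where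
  "vocabulary \<Gamma> V Acc Rej enc \<longleftrightarrow>
     finite V \<and> Acc \<subseteq> V \<and> Rej \<subseteq> V \<and> Acc \<inter> Rej = {} \<and> inj_on enc \<Gamma> \<and> enc ` \<Gamma> \<subseteq> V"

definition pencil_vocabulary ::
    "'g set \<Rightarrow> 'v set \<Rightarrow> 'v set \<Rightarrow> 'v set \<Rightarrow> ('g \<Rightarrow> 'v) \<Rightarrow> 'v \<Rightarrow> 'v \<Rightarrow> bool" where
  "pencil_vocabulary \<Gamma> V Acc Rej enc sep ret \<longleftrightarrow>
     vocabulary \<Gamma> V Acc Rej enc \<and> sep \<in> V \<and> ret \<in> V \<and> sep \<noteq> ret \<and>
     {sep, ret} \<inter> (enc ` \<Gamma> \<union> Acc \<union> Rej) = {}"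

definition append_next :: "('v list \<Rightarrow> 'v) \<Rightarrow> 'v list \<Rightarrow> 'v list" where
  "append_next \<pi> y = y @ [\<pi> y]"

text \<open>\<open>T'\<close> is determined by \<open>y\<close>, since it is the part strictly between the last \<open>sep\<close> and the
  final \<open>ret\<close>.\<close>

definition pencil_reduce :: "'v \<Rightarrow> 'v \<Rightarrow> 'v list \<Rightarrow> 'v list" where
  "pencil_reduce sep ret y =
     (if \<exists>T T'. y = T @ [sep] @ T' @ [ret] \<and> sep \<notin> set T' \<and> ret \<notin> set T'
      then THE T'. \<exists>T. y = T @ [sep] @ T' @ [ret] \<and> sep \<notin> set T' \<and> ret \<notin> set T'
      else y)"

text \<open>
  The parameter \<open>\<phi>\<close> is the reduction rule: \<^term>\<open>id\<close> for Chain-of-Thought and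
  \<^term>\<open>pencil_reduce sep ret\<close> for PENCIL.
\<close>

definition context_seq ::
    "('v list \<Rightarrow> 'v list) \<Rightarrow> ('v list \<Rightarrow> 'v) \<Rightarrow> 'v list \<Rightarrow> nat \<Rightarrow> 'v list" where
  "context_seq \<phi> \<pi> y0 j = ((\<lambda>y. \<phi> (append_next \<pi> y)) ^^ j) y0"

text \<open>Halting is determined by the token generated in step \<open>J\<close>, before any reduction.\<close>

definition halts_at ::
    "'v set \<Rightarrow> 'v set \<Rightarrow> ('v list \<Rightarrow> 'v list) \<Rightarrow> ('v list \<Rightarrow> 'v) \<Rightarrow> 'v list \<Rightarrow> nat \<Rightarrow> bool" where
  "halts_at Acc Rej \<phi> \<pi> y0 J \<longleftrightarrow>
     \<pi> (context_seq \<phi> \<pi> y0 J) \<in> Acc \<union> Rej \<and>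
     (\<forall>j < J. \<pi> (context_seq \<phi> \<pi> y0 j) \<notin> Acc \<union> Rej)"

definition process_decides ::
    "'g set \<Rightarrow> 'v set \<Rightarrow> 'v set \<Rightarrow> ('g \<Rightarrow> 'v) \<Rightarrow> ('v list \<Rightarrow> 'v list) \<Rightarrow> ('v list \<Rightarrow> 'v) \<Rightarrow>
     'g list set \<Rightarrow> bool" where
  "process_decides \<Gamma> Acc Rej enc \<phi> \<pi> L \<longleftrightarrow>
     (\<forall>w \<in> lists \<Gamma>. w \<noteq> [] \<longrightarrow>
        (\<exists>J. halts_at Acc Rej \<phi> \<pi> (map enc w) J \<and>
             (\<pi> (context_seq \<phi> \<pi> (map enc w) J) \<in> Acc \<longleftrightarrow> w \<in> L)))"

definition max_context_length ::
    "('v list \<Rightarrow> 'v list) \<Rightarrow> ('v list \<Rightarrow> 'v) \<Rightarrow> 'v list \<Rightarrow> nat \<Rightarrow> nat" where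
  "max_context_length \<phi> \<pi> y0 J =
     Max (insert (length y0) ((\<lambda>j. length (append_next \<pi> (context_seq \<phi> \<pi> y0 j))) ` {..J}))"

definition poly_bounded_context ::
    "'g set \<Rightarrow> 'v set \<Rightarrow> 'v set \<Rightarrow> ('g \<Rightarrow> 'v) \<Rightarrow> ('v list \<Rightarrow> 'v list) \<Rightarrow> ('v list \<Rightarrow> 'v) \<Rightarrow> bool" where
  "poly_bounded_context \<Gamma> Acc Rej enc \<phi> \<pi> \<longleftrightarrow>
     (\<exists>p :: nat poly. \<forall>w \<in> lists \<Gamma>. w \<noteq> [] \<longrightarrow>
        (\<forall>J. halts_at Acc Rej \<phi> \<pi> (map enc w) J \<longrightarrow>
             max_context_length \<phi> \<pi> (map enc w) J \<le> poly p (length w)))"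


section \<open>Transformers\<close>

record head_weights =
  W_Q :: "real mat"
  W_K :: "real mat"
  W_V :: "real mat"
  W_O :: "real mat"

record layer_weights =
  heads :: "head_weights list"
  W_0 :: "real mat"
  W_1 :: "real mat"
  W_2 :: "real mat"

text \<open>The decoding matrix has one row for each token; it is given as the map from tokens to rows.\<close>

record 'v transformer =
  token_emb :: "'v \<Rightarrow> real vec"
  pos_emb :: "real vec"
  layers :: "layer_weights list"
  decoding :: "'v \<Rightarrow> real vec"

definition head_dims :: "nat \<Rightarrow> nat \<Rightarrow> head_weights \<Rightarrow> bool" where
  "head_dims d dSA hw \<longleftrightarrow> {W_Q hw, W_K hw, W_V hw, W_O hw} \<subseteq> carrier_mat dSA d"

definition layer_dims :: "nat \<Rightarrow> nat \<Rightarrow> nat \<Rightarrow> nat \<Rightarrow> layer_weights \<Rightarrow> bool" where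
  "layer_dims d dSA dFF H ly \<longleftrightarrow>
     length (heads ly) = H \<and> (\<forall>hw \<in> set (heads ly). head_dims d dSA hw) \<and>
     {W_0 ly, W_1 ly, W_2 ly} \<subseteq> carrier_mat dFF d"

definition transformer_dims ::
    "'v set \<Rightarrow> nat \<Rightarrow> nat \<Rightarrow> nat \<Rightarrow> nat \<Rightarrow> nat \<Rightarrow> 'v transformer \<Rightarrow> bool" where
  "transformer_dims V d dSA dFF H N \<theta> \<longleftrightarrow>
     (\<forall>a \<in> V. token_emb \<theta> a \<in> carrier_vec d \<and> decoding \<theta> a \<in> carrier_vec d) \<and>
     pos_emb \<theta> \<in> carrier_vec d \<and>
     length (layers \<theta>) = N \<and> (\<forall>ly \<in> set (layers \<theta>). layer_dims d dSA dFF H ly)"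

definition is_transformer :: "'v set \<Rightarrow> 'v transformer \<Rightarrow> bool" where
  "is_transformer V \<theta> \<longleftrightarrow>
     (\<exists>d dSA dFF H N. 0 < d \<and> 0 < dSA \<and> 0 < dFF \<and> 0 < H \<and> 0 < N \<and>
        transformer_dims V d dSA dFF H N \<theta>)"

definition hardmax :: "nat set \<Rightarrow> (nat \<Rightarrow> real) \<Rightarrow> nat \<Rightarrow> real" where
  "hardmax S v j =
     (let M = {k. is_arg_max v (\<lambda>k. k \<in> S) k} in if j \<in> M then 1 / real (card M) else 0)"

text \<open>Hidden states are functions of the position; positions are numbered from 1.\<close>

definition attention :: "head_weights \<Rightarrow> (nat \<Rightarrow> real vec) \<Rightarrow> nat \<Rightarrow> nat \<Rightarrow> real" where
  "attention hw h i = hardmax {1..i} (\<lambda>j. (W_Q hw *\<^sub>v h i) \<bullet> (W_K hw *\<^sub>v h j))"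

definition head_output :: "head_weights \<Rightarrow> (nat \<Rightarrow> real vec) \<Rightarrow> nat \<Rightarrow> real vec" where
  "head_output hw h i =
     transpose_mat (W_O hw) *\<^sub>v
       vec (dim_row (W_V hw)) (\<lambda>k. \<Sum>j = 1..i. attention hw h i j * (W_V hw *\<^sub>v h j) $ k)"

definition attention_block :: "layer_weights \<Rightarrow> (nat \<Rightarrow> real vec) \<Rightarrow> nat \<Rightarrow> real vec" where
  "attention_block ly h i =
     h i + vec (dim_vec (h i)) (\<lambda>k. \<Sum>hw \<leftarrow> heads ly. head_output hw h i $ k)"

definition feed_forward :: "layer_weights \<Rightarrow> real vec \<Rightarrow> real vec" where
  "feed_forward ly u =
     u + transpose_mat (W_0 ly) *\<^sub>v
           vec (dim_row (W_0 ly)) (\<lambda>k. (W_1 ly *\<^sub>v u) $ k * max ((W_2 ly *\<^sub>v u) $ k) 0)"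

definition layer_map :: "layer_weights \<Rightarrow> (nat \<Rightarrow> real vec) \<Rightarrow> nat \<Rightarrow> real vec" where
  "layer_map ly h i = feed_forward ly (attention_block ly h i)"

definition embedding :: "'v transformer \<Rightarrow> 'v list \<Rightarrow> nat \<Rightarrow> real vec" where
  "embedding \<theta> x i = token_emb \<theta> (x ! (i - 1)) + real i \<cdot>\<^sub>v pos_emb \<theta>"

text \<open>\<open>fold\<close> applies the first layer of the list first.\<close>

definition hidden :: "'v transformer \<Rightarrow> 'v list \<Rightarrow> nat \<Rightarrow> real vec" where
  "hidden \<theta> x = fold layer_map (layers \<theta>) (embedding \<theta> x)"

definition logit :: "'v transformer \<Rightarrow> 'v list \<Rightarrow> 'v \<Rightarrow> real" where
  "logit \<theta> x a = decoding \<theta> a \<bullet> hidden \<theta> x (length x)"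

definition next_token :: "'v set \<Rightarrow> 'v transformer \<Rightarrow> 'v list \<Rightarrow> 'v" where
  "next_token V \<theta> x = arg_max (logit \<theta> x) (\<lambda>a. a \<in> V)"

text \<open>
  \<^const>\<open>arg_max\<close> picks an arbitrary maximiser. The next predicate expresses that on every sequence
  to which the transformer is applied before the process halts, there is no choice: the sequence is
  nonempty and the maximiser is unique.
\<close>

definition well_defined_on_runs ::
    "'g set \<Rightarrow> 'v set \<Rightarrow> 'v set \<Rightarrow> 'v set \<Rightarrow> ('g \<Rightarrow> 'v) \<Rightarrow> ('v list \<Rightarrow> 'v list) \<Rightarrow>
     'v transformer \<Rightarrow> bool" where
  "well_defined_on_runs \<Gamma> V Acc Rej enc \<phi> \<theta> \<longleftrightarrow>
     (\<forall>w \<in> lists \<Gamma>. w \<noteq> [] \<longrightarrow>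
        (\<forall>J. halts_at Acc Rej \<phi> (next_token V \<theta>) (map enc w) J \<longrightarrow>
          (\<forall>j \<le> J. let y = context_seq \<phi> (next_token V \<theta>) (map enc w) j in
             y \<noteq> [] \<and> (\<exists>!a. is_arg_max (logit \<theta> y) (\<lambda>a. a \<in> V) a))))"

end

theory Submission
  imports Defs
begin

text \<open>
  (i) The context is a segment of the tape of the given machine, one token per cell, with the state
  stored at the head. One round generates \<open>[SEP]\<close>, the successor configuration from left to right, and
  \<open>[RETURN]\<close>, so that the reduction replaces a configuration by its successor; the length stays within
  a constant factor of input length plus space. The new token at position \<open>k\<close> is a function of the
  preceding token and of the old tokens at positions \<open>k\<close> and \<open>k + 1\<close>. If \<open>m\<close> is the position of
  \<open>[SEP]\<close> and \<open>n\<close> the current one, the old tokens stand at \<open>n - m + 1\<close> and \<open>n - m + 2\<close>. A first layer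
  finds \<open>m\<close> by attending to \<open>[SEP]\<close> and squares the positions; a second layer attends to position \<open>t\<close>
  through the score \<open>2 * t * j - j\<^sup>2\<close> and looks up the new token in its feed-forward block.

  (ii) A Chain-of-Thought run takes at most as many steps as its context is long, so a one-tape
  machine with two tracks can repeatedly run the generator on a copy of the context.
\<close>

section \<open>Hardmax attention\<close>

text \<open>Attention scores are bilinear in the hidden states and the positional embedding is
  linear, so a score made from positions alone is monotone in the key position and cannot single out
  an interior one. A peak at \<open>t\<close> needs a quadratic term, hence a feed-forward block
  must supply \<open>j^2\<close> first; the gated unit \<open>v * max v 0\<close> is exactly the
  square on positions. In \<open>-(j - t)^2\<close> the term \<open>-t^2\<close> does not depend on
  the key and is dropped, so \<open>t\<close> only has to be linear in the query, which it is once
  the position of the separator is known. Positions are counted from the left end of the segment, so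
  a head that leaves on the left shifts every symbol by one; the old segment offers no place for
  this, and the shift has to be handed on from token to token. No clock is kept, as the number of
  machine steps may be exponential; lengths are bounded through the cells that a segment covers. In
  (ii) the simulated machine may spoil its copy of the context and leave rubbish on both sides of
  it, so every round also has to clean up.\<close>

lemma hardmax_nonneg: "0 \<le> hardmax S v j"
  by (simp add: hardmax_def Let_def)

lemma is_arg_max_finite_exists:
  fixes v :: "nat \<Rightarrow> real"
  assumes "finite S" "S \<noteq> {}"
  shows "\<exists>k. is_arg_max v (\<lambda>k. k \<in> S) k"
proof -
  obtain k where "k \<in> S" "v k = Max (v ` S)"
    using Max_in[of "v ` S"] assms by fastforce
  then show ?thesis
    using assms by (intro exI[of _ k]) (auto simp: is_arg_max_def not_less)
qed

lemma sum_hardmax: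
  assumes "finite S" "S \<noteq> {}"
  shows "(\<Sum>j\<in>S. hardmax S v j) = 1"
proof -
  let ?M = "{k. is_arg_max v (\<lambda>k. k \<in> S) k}"
  have sub: "?M \<subseteq> S" by (auto simp: is_arg_max_def)
  have fin: "finite ?M" using sub assms(1) finite_subset by blast
  have ne: "?M \<noteq> {}" using is_arg_max_finite_exists[OF assms] by blast
  have "(\<Sum>j\<in>S. hardmax S v j) = (\<Sum>j\<in>?M. 1 / real (card ?M))"
    unfolding hardmax_def Let_def
    using sub by (intro sum.mono_neutral_cong_right) (auto simp: assms)
  also have "\<dots> = 1" using fin ne by simp
  finally show ?thesis .
qed

text \<open>A convex combination obeys any common bound, ties or not. This controls the fetched
  values while no separator has occurred and nothing is known about the maximisers.\<close>

lemma sum_hardmax_le: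
  assumes "finite S" "S \<noteq> {}" "\<And>j. j \<in> S \<Longrightarrow> g j \<le> b"
  shows "(\<Sum>j\<in>S. hardmax S v j * g j) \<le> b"
proof -
  have "(\<Sum>j\<in>S. hardmax S v j * g j) \<le> (\<Sum>j\<in>S. hardmax S v j * b)"
    by (intro sum_mono mult_left_mono assms hardmax_nonneg)
  also have "\<dots> = b" by (simp add: sum_hardmax[OF assms(1,2)] flip: sum_distrib_right)
  finally show ?thesis .
qed

text \<open>The set of maximisers is the singleton \<open>{j0}\<close>, so the weights are a point
  mass and averaging becomes exact retrieval.\<close>

lemma sum_hardmax_unique:
  assumes "finite S" "j0 \<in> S" "\<And>j. j \<in> S \<Longrightarrow> j \<noteq> j0 \<Longrightarrow> v j < v j0"
  shows "(\<Sum>j\<in>S. hardmax S v j * g j) = g j0"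
proof -
  have M: "{k. is_arg_max v (\<lambda>k. k \<in> S) k} = {j0}"
  proof
    show "{j0} \<subseteq> {k. is_arg_max v (\<lambda>k. k \<in> S) k}"
      using assms by (auto simp: is_arg_max_def) (metis less_asym)
    show "{k. is_arg_max v (\<lambda>k. k \<in> S) k} \<subseteq> {j0}"
      using assms by (auto simp: is_arg_max_def)
  qed
  have "(\<Sum>j\<in>S. hardmax S v j * g j) = (\<Sum>j\<in>S. if j = j0 then g j0 else 0)"
    by (intro sum.cong) (auto simp: hardmax_def Let_def M)
  then show ?thesis using assms by simp
qed

section \<open>Weight matrices with sparse rows\<close>

definition lin :: "(real \<times> nat) list \<Rightarrow> nat \<Rightarrow> real" where
  "lin cs l = (\<Sum>(c, k) \<leftarrow> cs. if l = k then c else 0)"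

text \<open>Row \<open>k\<close> is the linear form listed in \<open>R k\<close> as pairs of a
  coefficient and a coordinate. Most rows of the weights are empty, and a list reduces a
  matrix-vector entry to the few terms that are present.\<close>

definition row_mat :: "nat \<Rightarrow> nat \<Rightarrow> (nat \<Rightarrow> (real \<times> nat) list) \<Rightarrow> real mat" where
  "row_mat r d R = mat r d (\<lambda>(k, l). lin (R k) l)"

lemma row_mat_carrier [simp]: "row_mat r d R \<in> carrier_mat r d"
  by (simp add: row_mat_def)

lemma row_mat_dims [simp]: "dim_row (row_mat r d R) = r" "dim_col (row_mat r d R) = d"
  by (simp_all add: row_mat_def)

lemma sum_lin:
  assumes "\<forall>(c, k) \<in> set cs. k < d"
  shows "(\<Sum>l = 0..<d. lin cs l * f l) = (\<Sum>(c, k) \<leftarrow> cs. c * f k)"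
  using assms
proof (induction cs)
  case Nil
  then show ?case by (simp add: lin_def)
next
  case (Cons p cs)
  obtain c k where p: "p = (c, k)" by (cases p)
  have "(\<Sum>l = 0..<d. lin (p # cs) l * f l)
      = (\<Sum>l = 0..<d. (if l = k then c * f l else 0)) + (\<Sum>l = 0..<d. lin cs l * f l)"
    unfolding sum.distrib[symmetric] by (intro sum.cong) (auto simp: lin_def p algebra_simps)
  then show ?case using Cons by (auto simp: p)
qed

lemma row_mat_mult:
  assumes "k < r" "dim_vec v = d" "\<forall>(c, l) \<in> set (R k). l < d"
  shows "(row_mat r d R *\<^sub>v v) $ k = (\<Sum>(c, l) \<leftarrow> R k. c * v $ l)"
proof -
  have "(row_mat r d R *\<^sub>v v) $ k = (\<Sum>l = 0..<d. lin (R k) l * v $ l)"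
    using assms by (simp add: row_mat_def scalar_prod_def)
  then show ?thesis using sum_lin[OF assms(3)] by simp
qed

lemma row_mat_mult_transpose:
  assumes "l < d" "dim_vec v = r"
  shows "(transpose_mat (row_mat r d R) *\<^sub>v v) $ l = (\<Sum>k = 0..<r. lin (R k) l * v $ k)"
  using assms by (simp add: row_mat_def scalar_prod_def)


definition ev :: "(real \<times> nat) list \<Rightarrow> real vec \<Rightarrow> real" where
  "ev cs v = (\<Sum>(c, l) \<leftarrow> cs. c * v $ l)"

lemma ev_simps [simp]: "ev [] v = 0" "ev ((c, l) # cs) v = c * v $ l + ev cs v"
  by (simp_all add: ev_def)

lemma lin_simps [simp]: "lin [] l = 0" "lin ((c, k) # cs) l = (if l = k then c else 0) + lin cs l"
  by (simp_all add: lin_def)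

lemma row_mat_ev:
  assumes "k < r" "dim_vec v = d" "\<forall>(c, l) \<in> set (R k). l < d"
  shows "(row_mat r d R *\<^sub>v v) $ k = ev (R k) v"
  using row_mat_mult[where R = R, OF assms] by (simp add: ev_def del: index_mult_mat_vec)

text \<open>With head dimension \<open>d\<close> the output matrix can be the identity, so that the
  rows of \<open>W_V\<close> say directly what is added to each coordinate of the hidden
  state.\<close>

lemma head_output_row_mat:
  assumes "W_V hw = row_mat d d R" "W_O hw = 1\<^sub>m d" "k < d"
    and "\<And>j. j \<in> {1..i} \<Longrightarrow> dim_vec (h j) = d" "\<forall>(c, l) \<in> set (R k). l < d"
  shows "head_output hw h i $ k = (\<Sum>j = 1..i. attention hw h i j * ev (R k) (h j))"
proof -
  have "head_output hw h i
      = vec d (\<lambda>k. \<Sum>j = 1..i. attention hw h i j * (row_mat d d R *\<^sub>v h j) $ k)"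
    using assms(1,2) by (simp add: head_output_def)
  then show ?thesis using assms
    by (auto intro!: sum.cong simp: row_mat_ev simp del: index_mult_mat_vec)
qed

text \<open>All key rows but the first two vanish, so the inner product collapses to two products.
  Two suffice: the fetch score has one term in \<open>j\<close> and one in
  \<open>j^2\<close>.\<close>

lemma attention_two_rows:
  assumes "W_Q hw = row_mat d d Q" "W_K hw = row_mat d d R" "2 \<le> d" "i \<ge> 1"
    and "\<And>j. j \<in> {1..i} \<Longrightarrow> dim_vec (h j) = d"
    and "\<And>k. k < d \<Longrightarrow> \<forall>(c, l) \<in> set (Q k). l < d" "\<And>k. k < d \<Longrightarrow> \<forall>(c, l) \<in> set (R k). l < d"
    and "\<And>k. 2 \<le> k \<Longrightarrow> R k = []"
    and "\<And>j. j \<in> {1..i} \<Longrightarrow> ev (Q 0) (h i) * ev (R 0) (h j) + ev (Q 1) (h i) * ev (R 1) (h j) = sc j"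
  shows "j \<in> {1..i} \<Longrightarrow> attention hw h i j = hardmax {1..i} sc j"
proof -
  have sc: "(W_Q hw *\<^sub>v h i) \<bullet> (W_K hw *\<^sub>v h j) = sc j" if j: "j \<in> {1..i}" for j
  proof -
    have "(W_Q hw *\<^sub>v h i) \<bullet> (W_K hw *\<^sub>v h j)
        = (\<Sum>k = 0..<d. (row_mat d d Q *\<^sub>v h i) $ k * (row_mat d d R *\<^sub>v h j) $ k)"
      by (simp add: scalar_prod_def assms(1,2) del: index_mult_mat_vec)
    also have "\<dots> = (\<Sum>k = 0..<d. ev (Q k) (h i) * ev (R k) (h j))"
      using assms(4-7) j by (intro sum.cong) (simp_all add: row_mat_ev del: index_mult_mat_vec)
    also have "\<dots> = (\<Sum>k \<in> {0, 1}. ev (Q k) (h i) * ev (R k) (h j))"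
    proof (intro sum.mono_neutral_right ballI)
      fix k assume "k \<in> {0..<d} - {0, 1}"
      then have "2 \<le> k" by auto
      then show "ev (Q k) (h i) * ev (R k) (h j) = 0" using assms(8) by simp
    qed (use assms(3) in auto)
    finally show ?thesis using assms(9)[OF j] by simp
  qed
  have "is_arg_max (\<lambda>j. (W_Q hw *\<^sub>v h i) \<bullet> (W_K hw *\<^sub>v h j)) (\<lambda>k. k \<in> {1..i})
      = is_arg_max sc (\<lambda>k. k \<in> {1..i})"
    by (intro ext) (auto simp: is_arg_max_def sc)
  then show "j \<in> {1..i} \<Longrightarrow> attention hw h i j = hardmax {1..i} sc j"
    by (simp add: attention_def hardmax_def)
qed

lemma feed_forward_row_mat:
  assumes "W_0 ly = row_mat D d R0" "W_1 ly = row_mat D d R1" "W_2 ly = row_mat D d R2"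
    and "dim_vec u = d" "l < d"
    and "\<And>k. k < D \<Longrightarrow> \<forall>(c, l) \<in> set (R1 k). l < d" "\<And>k. k < D \<Longrightarrow> \<forall>(c, l) \<in> set (R2 k). l < d"
  shows "feed_forward ly u $ l
    = u $ l + (\<Sum>k = 0..<D. lin (R0 k) l * (ev (R1 k) u * max (ev (R2 k) u) 0))"
  unfolding feed_forward_def assms(1-3)
  by (subst index_add_vec(1), simp add: assms,
      subst row_mat_mult_transpose, simp add: assms, simp,
      auto intro!: sum.cong simp: row_mat_ev assms simp del: index_mult_mat_vec)

lemma dim_feed_forward [simp]: "dim_vec (feed_forward ly u) = dim_col (W_0 ly)"
  by (simp add: feed_forward_def)

lemma dim_attention_block [simp]: "dim_vec (attention_block ly h i) = dim_vec (h i)"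
  by (simp add: attention_block_def)

lemma attention_block_nth:
  "k < dim_vec (h i) \<Longrightarrow>
    attention_block ly h i $ k = h i $ k + (\<Sum>hw \<leftarrow> heads ly. head_output hw h i $ k)"
  by (simp add: attention_block_def)

section \<open>A transformer for a local rule\<close>

text \<open>Tokens are numbers below \<open>K\<close>. In \<open>F a b c\<close>, \<open>a\<close>
  is the last token of the context, and \<open>b\<close> and \<open>c\<close> are the two tokens
  fetched from its old part.\<close>

locale token_rule =
  fixes K sep :: nat and F :: "nat \<Rightarrow> nat \<Rightarrow> nat \<Rightarrow> nat"
  assumes sep: "sep < K"
    and F: "a < K \<Longrightarrow> b < K \<Longrightarrow> c < K \<Longrightarrow> F a b c < K"
begin

abbreviation d :: nat where "d \<equiv> 4 * K + 5"
abbreviation D :: nat where "D \<equiv> K * (K * K)"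

text \<open>The second feed-forward block has one hidden unit per triple of tokens, whence its width
  \<open>D\<close>. The enumeration says which triple a unit stands for.\<close>

definition triple :: "nat \<Rightarrow> nat \<times> nat \<times> nat" where
  "triple = (SOME t. bij_betw t {0..<D} ({..<K} \<times> {..<K} \<times> {..<K}))"

lemma bij_triple: "bij_betw triple {0..<D} ({..<K} \<times> {..<K} \<times> {..<K})"
proof -
  have "\<exists>t. bij_betw t {0..<D} ({..<K} \<times> {..<K} \<times> {..<K})"
    using ex_bij_betw_nat_finite[of "{..<K} \<times> {..<K} \<times> {..<K}"]
    by (simp add: card_cartesian_product)
  then show ?thesis unfolding triple_def by (rule someI_ex)
qed

text \<open>Coordinates of a hidden state: the one-hot token from \<open>0\<close>, the one-hot fetched tokens from
  \<open>K\<close> and \<open>2 * K\<close>, the output from \<open>3 * K\<close>; then the constant \<open>1\<close>, the position, the position of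
  the separator, the indicator that a separator has occurred, and the square of the position.\<close>

definition locate_head :: head_weights where
  "locate_head = \<lparr>
     W_Q = row_mat d d (\<lambda>k. if k = 0 then [(1, 4 * K)] else []),
     W_K = row_mat d d (\<lambda>k. if k = 0 then [(1, sep)] else []),
     W_V = row_mat d d (\<lambda>k. if k = 4 * K + 2 then [(1, 4 * K + 1)]
                            else if k = 4 * K + 3 then [(1, sep)] else []),
     W_O = 1\<^sub>m d\<rparr>"

text \<open>All layers share the same number of heads. The second layer needs two, so the first is
  padded with a head of value zero.\<close>

definition idle_head :: head_weights where
  "idle_head = \<lparr>W_Q = 0\<^sub>m d d, W_K = 0\<^sub>m d d, W_V = row_mat d d (\<lambda>k. []), W_O = 1\<^sub>m d\<rparr>"

text \<open>At position \<open>n\<close> with separator position \<open>m\<close> the query is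
  \<open>(1, n - m + c)\<close> and the key of \<open>j\<close> is \<open>(- j^2, 2 * j)\<close>;
  their product is the score of the overview for \<open>t = n - m + c\<close>. The value copies the
  one-hot token into the block that starts at \<open>off\<close>.\<close>

definition fetch_head :: "real \<Rightarrow> nat \<Rightarrow> head_weights" where
  "fetch_head c off = \<lparr>
     W_Q = row_mat d d (\<lambda>k. if k = 0 then [(1, 4 * K)]
                            else if k = 1 then [(1, 4 * K + 1), (-1, 4 * K + 2), (c, 4 * K)] else []),
     W_K = row_mat d d (\<lambda>k. if k = 0 then [(-1, 4 * K + 4)]
                            else if k = 1 then [(2, 4 * K + 1)] else []),
     W_V = row_mat d d (\<lambda>k. if off \<le> k \<and> k < off + K then [(1, k - off)] else []),
     W_O = 1\<^sub>m d\<rparr>"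

text \<open>Hidden unit 0 multiplies the position by its positive part, which is its square. The
  other units are zero; the width is that of the second layer, as the layers share it.\<close>

definition locate_layer :: layer_weights where
  "locate_layer = \<lparr>
     heads = [locate_head, idle_head],
     W_0 = row_mat D d (\<lambda>k. if k = 0 then [(1, 4 * K + 4)] else []),
     W_1 = row_mat D d (\<lambda>k. if k = 0 then [(1, 4 * K + 1)] else []),
     W_2 = row_mat D d (\<lambda>k. if k = 0 then [(1, 4 * K + 1)] else [])\<rparr>"

text \<open>\<open>-2\<close> makes the second factor vanish unless both fetched tokens match and a separator has
  occurred.\<close>

definition fetch_layer :: layer_weights where
  "fetch_layer = \<lparr>
     heads = [fetch_head 1 K, fetch_head 2 (2 * K)],
     W_0 = row_mat D d (\<lambda>k. case triple k of (a, b, c) \<Rightarrow> [(1, 3 * K + F a b c)]),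
     W_1 = row_mat D d (\<lambda>k. case triple k of (a, b, c) \<Rightarrow> [(1, a)]),
     W_2 = row_mat D d (\<lambda>k. case triple k of (a, b, c) \<Rightarrow>
             [(1, K + b), (1, 2 * K + c), (1, 4 * K + 3), (-2, 4 * K)])\<rparr>"

text \<open>The extra terms in the decoding row of \<open>sep\<close> contribute
  \<open>1 - sep_seen\<close>: they make the transformer open a round when the context has no
  separator, and cancel as soon as it has one.\<close>

definition rule_transformer :: "nat transformer" where
  "rule_transformer = \<lparr>
     token_emb = (\<lambda>a. vec d (\<lambda>l. if l = a \<or> l = 4 * K then 1 else 0)),
     pos_emb = unit_vec d (4 * K + 1),
     layers = [locate_layer, fetch_layer],
     decoding = (\<lambda>a. vec d (lin ((1, 3 * K + a) #
       (if a = sep then [(1, 4 * K), (-1, 4 * K + 3)] else []))))\<rparr>"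

lemma is_transformer_rule: "is_transformer {..<K} rule_transformer"
  unfolding is_transformer_def
  by (rule exI[of _ d], rule exI[of _ d], rule exI[of _ D], rule exI[of _ 2], rule exI[of _ 2])
    (use sep in \<open>auto simp: transformer_dims_def rule_transformer_def layer_dims_def locate_layer_def
      fetch_layer_def head_dims_def locate_head_def idle_head_def fetch_head_def\<close>)


section \<open>Hidden states and logits on a fixed context\<close>

context
  fixes x :: "nat list"
  assumes x: "x \<in> lists {..<K}" "x \<noteq> []"
begin

lemma nth_x: "j \<in> {1..length x} \<Longrightarrow> x ! (j - 1) < K"
  using x by (auto simp: in_lists_conv_set)

lemma length_x: "1 \<le> length x"
  using x by (cases x) auto

abbreviation h0 :: "nat \<Rightarrow> real vec" where "h0 \<equiv> embedding rule_transformer x"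
abbreviation h1 :: "nat \<Rightarrow> real vec" where "h1 \<equiv> layer_map locate_layer h0"
abbreviation u2 :: "real vec" where "u2 \<equiv> attention_block fetch_layer h1 (length x)"

text \<open>Scores are 0 or 1, so this is the mean position of the separators: the wanted position
  if there is exactly one. Without any it is the mean of all positions, a value that
  \<open>sep_seen\<close> then keeps from having an effect.\<close>

definition sep_position :: "nat \<Rightarrow> real" where
  "sep_position n =
     (\<Sum>i = 1..n. hardmax {1..n} (\<lambda>i. of_bool (x ! (i - 1) = sep)) i * real i)"

definition sep_seen :: "nat \<Rightarrow> real" where
  "sep_seen n =
     (\<Sum>i = 1..n. hardmax {1..n} (\<lambda>i. of_bool (x ! (i - 1) = sep)) i * of_bool (x ! (i - 1) = sep))"

text \<open>Up to a term independent of \<open>j\<close>, the score is minus the square of the distance of \<open>j\<close>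
  from \<open>length x - sep_position + c\<close>.\<close>

definition fetch_score :: "real \<Rightarrow> nat \<Rightarrow> real" where
  "fetch_score c j = (real (length x) - sep_position (length x) + c) * (2 * real j) - real j ^ 2"

definition fetched :: "real \<Rightarrow> nat \<Rightarrow> real" where
  "fetched c b =
     (\<Sum>j = 1..length x. hardmax {1..length x} (fetch_score c) j * of_bool (x ! (j - 1) = b))"

lemma dim_h0 [simp]: "dim_vec (h0 j) = d"
  by (simp add: embedding_def rule_transformer_def)

lemma h0_nth:
  "j \<in> {1..length x} \<Longrightarrow> l < d \<Longrightarrow>
    h0 j $ l = (if l = x ! (j - 1) \<or> l = 4 * K then 1 else if l = 4 * K + 1 then real j else 0)"
  using nth_x[of j] by (auto simp: embedding_def rule_transformer_def)

lemma dim_h1 [simp]: "dim_vec (h1 j) = d"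
  by (simp add: layer_map_def locate_layer_def)

lemma idle_head_output: "k < d \<Longrightarrow> head_output idle_head h0 i $ k = 0"
  by (subst head_output_row_mat[where d = d and R = "\<lambda>k. []"]) (simp_all add: idle_head_def)

lemma locate_attention:
  assumes "n \<in> {1..length x}" "j \<in> {1..n}"
  shows "attention locate_head h0 n j = hardmax {1..n} (\<lambda>i. of_bool (x ! (i - 1) = sep)) j"
  using assms sep
  by (intro attention_two_rows[where d = d and Q = "\<lambda>k. if k = 0 then [(1, 4 * K)] else []"
        and R = "\<lambda>k. if k = 0 then [(1, sep)] else []"])
    (auto simp: locate_head_def h0_nth)

lemma locate_head_output:
  assumes "n \<in> {1..length x}" "k < d"
  shows "head_output locate_head h0 n $ k =
    (if k = 4 * K + 2 then sep_position n else if k = 4 * K + 3 then sep_seen n else 0)"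
proof -
  let ?R = "\<lambda>k. if k = 4 * K + 2 then [(1, 4 * K + 1)] else if k = 4 * K + 3 then [(1, sep)] else []"
  have "head_output locate_head h0 n $ k
      = (\<Sum>j = 1..n. attention locate_head h0 n j * ev (?R k) (h0 j))"
    using assms sep
    by (intro head_output_row_mat[where d = d]) (auto simp: locate_head_def)
  also have "\<dots> = (\<Sum>j = 1..n. hardmax {1..n} (\<lambda>i. of_bool (x ! (i - 1) = sep)) j *
      (if k = 4 * K + 2 then real j else if k = 4 * K + 3 then of_bool (x ! (j - 1) = sep) else 0))"
  proof (intro sum.cong refl)
    fix j assume j: "j \<in> {1..n}"
    then have j': "j \<in> {1..length x}" using assms(1) by auto
    have "ev (?R k) (h0 j) =
      (if k = 4 * K + 2 then real j else if k = 4 * K + 3 then of_bool (x ! (j - 1) = sep) else 0)"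
      using sep nth_x[OF j'] by (auto simp: h0_nth[OF j'])
    then show "attention locate_head h0 n j * ev (?R k) (h0 j) =
      hardmax {1..n} (\<lambda>i. of_bool (x ! (i - 1) = sep)) j *
      (if k = 4 * K + 2 then real j else if k = 4 * K + 3 then of_bool (x ! (j - 1) = sep) else 0)"
      using locate_attention[OF assms(1) j] by simp
  qed
  finally show ?thesis by (auto simp: sep_position_def sep_seen_def)
qed

lemma h1_nth:
  assumes j: "j \<in> {1..length x}" and l: "l < d"
  shows "h1 j $ l = h0 j $ l +
    (if l = 4 * K + 2 then sep_position j else if l = 4 * K + 3 then sep_seen j
     else if l = 4 * K + 4 then real j ^ 2 else 0)"
proof -
  let ?u = "attention_block locate_layer h0 j"
  have u: "?u $ l = h0 j $ l +
      (if l = 4 * K + 2 then sep_position j else if l = 4 * K + 3 then sep_seen j else 0)"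
    if "l < d" for l
    using that j by (simp add: attention_block_nth locate_layer_def locate_head_output idle_head_output)
  let ?R = "\<lambda>k. if k = 0 then [(1, 4 * K + 1)] else []"
  have u_pos: "?u $ (4 * K + 1) = real j"
    using j nth_x[OF j] by (simp add: u h0_nth)
  have D: "0 < D" using sep by simp
  have "h1 j $ l = ?u $ l + (\<Sum>k = 0..<D. lin (if k = 0 then [(1, 4 * K + 4)] else []) l *
      (ev (?R k) ?u * max (ev (?R k) ?u) 0))"
    unfolding layer_map_def using l
    by (intro feed_forward_row_mat[where d = d]) (auto simp: locate_layer_def)
  also have "(\<Sum>k = 0..<D. lin (if k = 0 then [(1, 4 * K + 4)] else []) l *
      (ev (?R k) ?u * max (ev (?R k) ?u) 0)) = (\<Sum>k = 0..<D. if k = 0 then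
      (if l = 4 * K + 4 then real j ^ 2 else 0) else 0)"
    using u_pos by (intro sum.cong) (auto simp: power2_eq_square)
  also have "\<dots> = (if l = 4 * K + 4 then real j ^ 2 else 0)"
    using D by (simp add: sum.delta)
  finally show ?thesis using l by (simp add: u)
qed

lemma fetch_attention:
  assumes "j \<in> {1..length x}"
  shows "attention (fetch_head c off) h1 (length x) j = hardmax {1..length x} (fetch_score c) j"
proof (rule attention_two_rows[where d = d])
  show "W_Q (fetch_head c off) = row_mat d d (\<lambda>k. if k = 0 then [(1, 4 * K)]
      else if k = 1 then [(1, 4 * K + 1), (-1, 4 * K + 2), (c, 4 * K)] else [])"
    "W_K (fetch_head c off) = row_mat d d (\<lambda>k. if k = 0 then [(-1, 4 * K + 4)]
      else if k = 1 then [(2, 4 * K + 1)] else [])"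
    by (simp_all add: fetch_head_def)
next
  fix i assume i: "i \<in> {1..length x}"
  have n: "length x \<in> {1..length x}" using length_x by simp
  show "ev (if (0::nat) = 0 then [(1, 4 * K)] else if (0::nat) = 1
        then [(1, 4 * K + 1), (-1, 4 * K + 2), (c, 4 * K)] else []) (h1 (length x)) *
      ev (if (0::nat) = 0 then [(-1, 4 * K + 4)] else if (0::nat) = 1 then [(2, 4 * K + 1)] else []) (h1 i) +
      ev (if (1::nat) = 0 then [(1, 4 * K)] else if (1::nat) = 1
        then [(1, 4 * K + 1), (-1, 4 * K + 2), (c, 4 * K)] else []) (h1 (length x)) *
      ev (if (1::nat) = 0 then [(-1, 4 * K + 4)] else if (1::nat) = 1 then [(2, 4 * K + 1)] else []) (h1 i) =
      fetch_score c i"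
    using nth_x[OF i] nth_x[OF n]
    by (simp add: h1_nth[OF i] h1_nth[OF n] h0_nth[OF i] h0_nth[OF n] fetch_score_def)
qed (use assms length_x in auto)

lemma fetch_head_output:
  assumes "k < d" "off + K \<le> d"
  shows "head_output (fetch_head c off) h1 (length x) $ k =
    (if off \<le> k \<and> k < off + K then fetched c (k - off) else 0)"
proof -
  let ?R = "\<lambda>k. if off \<le> k \<and> k < off + K then [(1, k - off)] else []"
  have "head_output (fetch_head c off) h1 (length x) $ k
      = (\<Sum>j = 1..length x. attention (fetch_head c off) h1 (length x) j * ev (?R k) (h1 j))"
    using assms by (intro head_output_row_mat[where d = d]) (auto simp: fetch_head_def)
  also have "\<dots> = (\<Sum>j = 1..length x. hardmax {1..length x} (fetch_score c) j *
      (if off \<le> k \<and> k < off + K then of_bool (x ! (j - 1) = k - off) else 0))"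
  proof (intro sum.cong refl)
    fix j assume j: "j \<in> {1..length x}"
    have "k - off < K" if "k < off + K" using that sep by auto
    then have "ev (?R k) (h1 j) =
        (if off \<le> k \<and> k < off + K then of_bool (x ! (j - 1) = k - off) else 0)"
      by (auto simp: h1_nth[OF j] h0_nth[OF j])
    then show "attention (fetch_head c off) h1 (length x) j * ev (?R k) (h1 j) =
        hardmax {1..length x} (fetch_score c) j *
        (if off \<le> k \<and> k < off + K then of_bool (x ! (j - 1) = k - off) else 0)"
      using fetch_attention[OF j] by simp
  qed
  finally show ?thesis by (auto simp: fetched_def)
qed

lemma u2_nth:
  assumes "l < d"
  shows "u2 $ l = h1 (length x) $ l + (if K \<le> l \<and> l < 2 * K then fetched 1 (l - K)
    else if 2 * K \<le> l \<and> l < 3 * K then fetched 2 (l - 2 * K) else 0)"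
  using assms by (auto simp: attention_block_nth fetch_layer_def fetch_head_output)

lemma hidden_eq: "hidden rule_transformer x (length x) = feed_forward fetch_layer u2"
  by (simp add: hidden_def rule_transformer_def layer_map_def[of fetch_layer])

text \<open>The sum over hidden units is reindexed by triples. The last token needs no fetching,
  because the state being updated sits at its position and still contains its one-hot code.\<close>

lemma hidden_nth:
  assumes l: "l < d"
  shows "hidden rule_transformer x (length x) $ l = u2 $ l +
    (\<Sum>(a, b, c) \<in> {..<K} \<times> {..<K} \<times> {..<K}. of_bool (l = 3 * K + F a b c) *
       (of_bool (a = last x) *
        max (fetched 1 b + fetched 2 c + sep_seen (length x) - 2) 0))"
    (is "_ = _ + (\<Sum>t \<in> ?T. ?g t)")
proof -
  have n: "length x \<in> {1..length x}" using length_x by simp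
  have lst: "x ! (length x - 1) = last x" using x by (simp add: last_conv_nth)
  have T: "fst (triple k) < K" "fst (snd (triple k)) < K" "snd (snd (triple k)) < K" if "k < D" for k
    using bij_betwE[OF bij_triple] that by (force)+
  let ?R1 = "\<lambda>k. case triple k of (a, b, c) \<Rightarrow> [(1, a)]"
  let ?R2 = "\<lambda>k. case triple k of (a, b, c) \<Rightarrow>
    [(1, K + b), (1, 2 * K + c), (1, 4 * K + 3), (-2, 4 * K)]"
  let ?R0 = "\<lambda>k. case triple k of (a, b, c) \<Rightarrow> [(1, 3 * K + F a b c)]"
  have "hidden rule_transformer x (length x) $ l = u2 $ l + (\<Sum>k = 0..<D.
      lin (?R0 k) l * (ev (?R1 k) u2 * max (ev (?R2 k) u2) 0))"
    unfolding hidden_eq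
  proof (rule feed_forward_row_mat[where d = d])
    show "\<forall>(c, l)\<in>set (?R1 k). l < d" if "k < D" for k
      using T[OF that] by (cases "triple k") auto
    show "\<forall>(c, l)\<in>set (?R2 k). l < d" if "k < D" for k
      using T[OF that] by (cases "triple k") auto
  qed (use l in \<open>simp_all add: fetch_layer_def\<close>)
  also have "(\<Sum>k = 0..<D. lin (?R0 k) l * (ev (?R1 k) u2 * max (ev (?R2 k) u2) 0))
      = (\<Sum>k = 0..<D. ?g (triple k))"
  proof (intro sum.cong refl)
    fix k assume "k \<in> {0..<D}"
    then have k: "k < D" by simp
    obtain a b c where t: "triple k = (a, b, c)" by (cases "triple k")
    have abc: "a < K" "b < K" "c < K" using T[OF k] t by auto
    show "lin (?R0 k) l * (ev (?R1 k) u2 * max (ev (?R2 k) u2) 0) = ?g (triple k)"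
      using abc nth_x[OF n]
      by (auto simp: t u2_nth h1_nth[OF n] h0_nth[OF n] lst[simplified] algebra_simps)
  qed
  also have "\<dots> = (\<Sum>t \<in> ?T. ?g t)"
    using sum.reindex_bij_betw[OF bij_triple] by simp
  finally show ?thesis .
qed

lemma logit_eq:
  assumes "a < K"
  shows "logit rule_transformer x a = hidden rule_transformer x (length x) $ (3 * K + a) +
    (if a = sep then 1 - sep_seen (length x) else 0)"
proof -
  have n: "length x \<in> {1..length x}" using length_x by simp
  have dim: "dim_vec (hidden rule_transformer x (length x)) = d"
    by (simp add: hidden_eq fetch_layer_def)
  let ?cs = "(1, 3 * K + a) # (if a = sep then [(1, 4 * K), (-1, 4 * K + 3)] else [])"
  have "logit rule_transformer x a
      = (\<Sum>l = 0..<d. lin ?cs l * hidden rule_transformer x (length x) $ l)"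
  proof -
    have "decoding rule_transformer a = vec d (lin ?cs)"
      by (simp add: rule_transformer_def del: lin_simps)
    then show ?thesis
      by (auto simp: logit_def scalar_prod_def dim simp del: lin_simps intro!: sum.cong)
  qed
  also have "\<dots> = (\<Sum>(c, l) \<leftarrow> ?cs. c * hidden rule_transformer x (length x) $ l)"
    using assms by (intro sum_lin) auto
  also have "\<dots> = hidden rule_transformer x (length x) $ (3 * K + a) +
    (if a = sep then hidden rule_transformer x (length x) $ (4 * K)
       - hidden rule_transformer x (length x) $ (4 * K + 3) else 0)"
    by simp
  also have "hidden rule_transformer x (length x) $ (4 * K) = 1"
  proof -
    \<comment> \<open>\<open>F\<close> stays below \<open>K\<close>, so the units write only to the
      block from \<open>3 * K\<close> up to \<open>4 * K - 1\<close> and leave the constant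
      alone.\<close>
    have "(\<Sum>t \<in> {..<K} \<times> {..<K} \<times> {..<K}. case t of (a, b, c) \<Rightarrow> of_bool (4 * K = 3 * K + F a b c) *
       (of_bool (a = last x) *
        max (fetched 1 b + fetched 2 c + sep_seen (length x) - 2) 0)) = 0"
    proof (intro sum.neutral ballI)
      fix t assume "t \<in> {..<K} \<times> {..<K} \<times> {..<K}"
      then show "(case t of (a, b, c) \<Rightarrow> of_bool (4 * K = 3 * K + F a b c) *
       (of_bool (a = last x) *
        max (fetched 1 b + fetched 2 c + sep_seen (length x) - 2) 0)) = 0"
        using F by fastforce
    qed
    then show ?thesis using nth_x[OF n]
      by (simp add: hidden_nth u2_nth h1_nth[OF n] h0_nth[OF n])
  qed
  also have "hidden rule_transformer x (length x) $ (4 * K + 3) = sep_seen (length x)"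
  proof -
    have "(\<Sum>t \<in> {..<K} \<times> {..<K} \<times> {..<K}. case t of (a, b, c) \<Rightarrow> of_bool (4 * K + 3 = 3 * K + F a b c) *
       (of_bool (a = last x) *
        max (fetched 1 b + fetched 2 c + sep_seen (length x) - 2) 0)) = 0"
    proof (intro sum.neutral ballI)
      fix t assume "t \<in> {..<K} \<times> {..<K} \<times> {..<K}"
      then show "(case t of (a, b, c) \<Rightarrow> of_bool (4 * K + 3 = 3 * K + F a b c) *
       (of_bool (a = last x) *
        max (fetched 1 b + fetched 2 c + sep_seen (length x) - 2) 0)) = 0"
        using F by fastforce
    qed
    then show ?thesis using nth_x[OF n]
      by (simp add: hidden_nth u2_nth h1_nth[OF n] h0_nth[OF n])
  qed
  finally show ?thesis .
qed

end

text \<open>Each fetched value is at most 1 and \<open>sep_seen\<close> is 0, so after subtracting 2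
  no unit has a positive argument. Only the decoding row of \<open>sep\<close> is left, and it gives
  1.\<close>

lemma logit_no_sep:
  assumes x: "x \<in> lists {..<K}" "x \<noteq> []" and "sep \<notin> set x" and a: "a < K"
  shows "logit rule_transformer x a = of_bool (a = sep)"
proof -
  have n: "length x \<in> {1..length x}" using length_x[OF x] by simp
  have seen: "sep_seen x (length x) = 0"
  proof -
    have "x ! (j - 1) \<noteq> sep" if "j \<in> {1..length x}" for j
      using that assms(3) nth_mem[of "j - 1" x] by auto
    then show ?thesis unfolding sep_seen_def[OF x] by (intro sum.neutral) auto
  qed
  have le: "fetched x c b \<le> 1" for c b
    unfolding fetched_def[OF x] using n by (intro sum_hardmax_le) auto
  have "hidden rule_transformer x (length x) $ (3 * K + a) = 0"
  proof -
    have "max (fetched x 1 b + fetched x 2 c + sep_seen x (length x) - 2) 0 = 0" for b c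
      using le[of 1 b] le[of 2 c] seen by simp
    then have "hidden rule_transformer x (length x) $ (3 * K + a) = u2 x $ (3 * K + a)"
      using a by (simp add: hidden_nth[OF x] case_prod_unfold)
    also have "\<dots> = 0"
      using a n nth_x[OF x n] by (simp add: u2_nth[OF x] h1_nth[OF x] h0_nth[OF x])
    finally show ?thesis .
  qed
  then show ?thesis using logit_eq[OF x a] seen by simp
qed

text \<open>With a single separator both layers have unique maximisers: the first finds
  \<open>m = length y + 1\<close>, so \<open>t = n - m + c\<close> is \<open>length z + c\<close>,
  and completing the square shows that the fetch score peaks there. List indices start at 0, hence
  \<open>length z\<close> and \<open>length z + 1\<close> in the conclusion.\<close>

lemma logit_sep:
  assumes y: "y \<in> lists {..<K}" "y \<noteq> []" "sep \<notin> set y" and z: "z \<in> lists {..<K}" "sep \<notin> set z"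
    and a: "a < K"
  defines "x \<equiv> y @ [sep] @ z"
  shows "logit rule_transformer x a
    = of_bool (a = F (last x) (x ! length z) (x ! (length z + 1)))"
proof -
  have x: "x \<in> lists {..<K}" "x \<noteq> []" using y z sep by (auto simp: x_def)
  have n: "length x \<in> {1..length x}" using length_x[OF x] by simp
  let ?m = "length y + 1"
  have m: "?m \<in> {1..length x}" by (simp add: x_def)
  have at: "x ! (j - 1) = sep \<longleftrightarrow> j = ?m" if j: "j \<in> {1..length x}" for j
  proof -
    consider "j - 1 < length y" | "j = ?m" | "j - 1 > length y" using j by fastforce
    then show ?thesis
    proof cases
      case 1
      then have "x ! (j - 1) = y ! (j - 1)" by (simp add: x_def nth_append)
      then have "x ! (j - 1) \<noteq> sep" using y(3) 1 by (metis nth_mem)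
      then show ?thesis using 1 by auto
    next
      case 2
      then show ?thesis by (simp add: x_def)
    next
      case 3
      then have "x ! (j - 1) = z ! (j - 2 - length y)" "j - 2 - length y < length z"
        using j by (auto simp: x_def nth_append nth_Cons' numeral_2_eq_2)
      then have "x ! (j - 1) \<noteq> sep" using z(2) by (metis nth_mem)
      then show ?thesis using 3 by auto
    qed
  qed
  have at_m: "x ! length y = sep" by (simp add: x_def)
  have seen: "sep_seen x (length x) = 1"
    unfolding sep_seen_def[OF x] by (subst sum_hardmax_unique[of _ ?m]) (use m at at_m in auto)
  have pos: "sep_position x (length x) = real ?m"
    unfolding sep_position_def[OF x] by (subst sum_hardmax_unique[of _ ?m]) (use m at at_m in auto)
  have len: "real (length x) - real ?m = real (length z)" by (simp add: x_def)
  have fetched: "fetched x (real c) b = of_bool (x ! (length z + c - 1) = b)"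
    if c: "c \<in> {1, 2}" for c b
  proof -
    let ?t = "length z + c"
    \<comment> \<open>For \<open>c = 2\<close> the target lies inside the context only because
      \<open>y\<close> is nonempty.\<close>
    have t: "?t \<in> {1..length x}" using c y(2) by (cases y) (auto simp: x_def)
    have score: "fetch_score x (real c) j = real ?t ^ 2 - (real j - real ?t) ^ 2" for j
      unfolding fetch_score_def[OF x] pos len by (simp add: power2_eq_square algebra_simps)
    show ?thesis unfolding fetched_def[OF x]
      by (subst sum_hardmax_unique[of _ ?t]) (use t in \<open>auto simp: score\<close>)
  qed
  have f1: "fetched x 1 b = of_bool (x ! length z = b)" for b using fetched[of 1] by simp
  have f2: "fetched x 2 b = of_bool (x ! (length z + 1) = b)" for b using fetched[of 2] by simp
  let ?p = "(last x, x ! length z, x ! (length z + 1))"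
  have K3: "?p \<in> {..<K} \<times> {..<K} \<times> {..<K}"
  proof -
    have "length z < length x" "length z + 1 < length x" using y(2) by (auto simp: x_def)
    then show ?thesis using x by (auto simp: in_lists_conv_set)
  qed
  have u2: "u2 x $ (3 * K + a) = 0"
    using a n nth_x[OF x n] by (simp add: u2_nth[OF x] h1_nth[OF x] h0_nth[OF x])
  have lt: "3 * K + a < d" using a by simp
  \<comment> \<open>The matching triple gives \<open>1 + 1 + 1 - 2 = 1\<close>. A wrong fetched
    token brings the argument of the maximum down to 0 or less, and a wrong last token makes the
    first factor 0.\<close>
  have "hidden rule_transformer x (length x) $ (3 * K + a)
      = (\<Sum>t \<in> {..<K} \<times> {..<K} \<times> {..<K}. if t = ?p
           then of_bool (a = F (last x) (x ! length z) (x ! (length z + 1))) else 0)"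
    unfolding hidden_nth[OF x lt] u2 seen f1 f2 add_0
    by (rule sum.cong) (rule refl, auto simp: of_bool_def max_def split: if_splits)
  also have "\<dots> = of_bool (a = F (last x) (x ! length z) (x ! (length z + 1)))"
    using K3 by (subst sum.delta) auto
  finally show ?thesis using logit_eq[OF x a] seen by simp
qed

lemma next_token_of_bool_logit:
  assumes "t < K" "\<And>a. a < K \<Longrightarrow> logit rule_transformer x a = of_bool (a = t)"
  shows "next_token {..<K} rule_transformer x = t"
    and "\<exists>!a. is_arg_max (logit rule_transformer x) (\<lambda>a. a \<in> {..<K}) a"
proof -
  have *: "is_arg_max (logit rule_transformer x) (\<lambda>a. a \<in> {..<K}) a \<longleftrightarrow> a = t" for a
  proof
    assume "is_arg_max (logit rule_transformer x) (\<lambda>a. a \<in> {..<K}) a"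
    then have "a < K" "\<not> logit rule_transformer x a < logit rule_transformer x t"
      using assms(1) by (auto simp: is_arg_max_def)
    then show "a = t" using assms by (auto split: if_splits)
  next
    assume "a = t"
    then show "is_arg_max (logit rule_transformer x) (\<lambda>a. a \<in> {..<K}) a"
      using assms by (simp add: is_arg_max_def)
  qed
  then show "\<exists>!a. is_arg_max (logit rule_transformer x) (\<lambda>a. a \<in> {..<K}) a"
    unfolding * by simp
  show "next_token {..<K} rule_transformer x = t"
    unfolding next_token_def arg_max_def by (rule some_equality) (simp_all only: *)
qed

end

section \<open>PENCIL simulates space-bounded machines\<close>

lemma config_after_halted:
  assumes "halted M (config_after M w k)" "k \<le> n"
  shows "config_after M w n = config_after M w k"
proof -
  have "(tm_step M ^^ j) c = c" if "halted M c" for j c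
    using that by (induction j) (auto simp: tm_step_def)
  then show ?thesis using assms funpow_add[of "n - k" k "tm_step M"]
    by (simp add: config_after_def)
qed

text \<open>Context bound and well-definedness speak of every halting time, while the simulation
  exhibits one.\<close>

lemma halts_at_unique:
  "halts_at A R \<phi> \<pi> y J \<Longrightarrow> halts_at A R \<phi> \<pi> y J' \<Longrightarrow> J = J'"
  unfolding halts_at_def by (metis linorder_neqE_nat)

text \<open>A carry hands information to the next position: the head moves right into it, or the symbol of
  this position is still to be written because a cell was inserted at the left end. \<open>Final\<close> marks a
  cell added at the right end.\<close>

datatype 'g carry = Keep | Put_Head nat | Push "'g symbol" | Final

text \<open>A \<open>Cell\<close> holds a symbol, the state if the head is here, and the carry for
  the next token of the same round. Prompt tokens are separate because a prompt does not mark the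
  head.\<close>

datatype 'g token =
    Input 'g | Cell "'g symbol" "nat option" "'g carry" | Sep | Return | Accept | Reject

fun carry_of :: "'g token \<Rightarrow> 'g carry" where
  "carry_of (Cell s o' c) = c"
| "carry_of _ = Keep"

text \<open>Reversal turns the last separator into the first one, so \<open>takeWhile\<close>
  recovers the part behind it and the description in \<open>pencil_reduce\<close> is unique.\<close>

lemma pencil_reduce_return:
  assumes "sep \<notin> set z" "ret \<notin> set z" "sep \<noteq> ret"
  shows "pencil_reduce sep ret (y @ [sep] @ z @ [ret]) = z"
proof -
  have uniq: "z' = z" if "y @ sep # z = T @ sep # z'" "sep \<notin> set z'" for T z'
  proof -
    have "rev z @ sep # rev y = rev z' @ sep # rev T"
      using that(1) by (metis append.assoc append_Cons append_Nil butlast_snoc rev.simps(2) rev_append)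
    moreover have "takeWhile (\<lambda>a. a \<noteq> sep) (rev u @ sep # v) = rev u" if "sep \<notin> set u" for u v
      using that by (subst takeWhile_append2) auto
    ultimately show "z' = z" using assms(1) that(2) by (metis rev_rev_ident)
  qed
  show ?thesis unfolding pencil_reduce_def
    by (subst if_P) (use assms in \<open>auto intro!: the_equality dest: uniq\<close>)
qed

lemma pencil_reduce_other: "t \<noteq> ret \<Longrightarrow> pencil_reduce sep ret (y @ [t]) = y @ [t]"
  unfolding pencil_reduce_def by auto

section \<open>The rewriting rule and one round on tokens\<close>

locale tm_pencil =
  fixes \<Gamma> :: "'g set" and M :: "'g tm"
  assumes finite_\<Gamma>: "finite \<Gamma>" and M: "turing_machine \<Gamma> M"
begin

definition halting :: "nat \<Rightarrow> bool" where
  "halting q \<longleftrightarrow> q = accept_state M \<or> q = reject_state M"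

text \<open>\<open>p\<close> is the last token generated, \<open>x\<close> is the token of the previous configuration at the
  position to be rewritten, and \<open>x'\<close> is the token after \<open>x\<close>.\<close>

definition rule :: "'g token \<Rightarrow> 'g token \<Rightarrow> 'g token \<Rightarrow> 'g token" where
  "rule p x x' =
    (if carry_of p = Final then Return else
     case x of
       Input a \<Rightarrow> Cell (Letter a) (if p = Sep then Some (start_state M) else None) Keep
     | Sep \<Rightarrow> (case carry_of p of
           Put_Head q \<Rightarrow> Cell Blank (Some q) Final
         | Push s \<Rightarrow> Cell s None Final
         | _ \<Rightarrow> Return)
     | Cell s (Some q) c \<Rightarrow>
         if q = accept_state M then Accept else if q = reject_state M then Reject else
         (case delta M q s of (q', s', mv) \<Rightarrow>
           (case mv of
              Stay \<Rightarrow> Cell s' (Some q') Keep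
            | MoveRight \<Rightarrow> Cell s' None (Put_Head q')
            | MoveLeft \<Rightarrow> if p = Sep then Cell Blank (Some q') (Push s') else Cell s' None Keep))
     | Cell s None c \<Rightarrow> (case carry_of p of
           Put_Head q \<Rightarrow> Cell s (Some q) Keep
         | Push s' \<Rightarrow> Cell s' None (Push s)
         | _ \<Rightarrow> (case x' of
               Cell t (Some q) c \<Rightarrow> if halting q then Cell s None Keep else
                 (case delta M q t of (q', t', mv) \<Rightarrow>
                   Cell s (if mv = MoveLeft then Some q' else None) Keep)
             | _ \<Rightarrow> Cell s None Keep))
     | _ \<Rightarrow> Return)"

definition carries :: "'g carry set" where
  "carries = {Keep, Final} \<union> Put_Head ` states M \<union> Push ` symbols M"

definition tokens :: "'g token set" where
  "tokens = Input ` \<Gamma>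
     \<union> (\<lambda>(s, o', c). Cell s o' c) ` (symbols M \<times> ({None} \<union> Some ` states M) \<times> carries)
     \<union> {Sep, Return, Accept, Reject}"

lemma finite_tokens: "finite tokens"
  using M finite_\<Gamma> by (auto simp: tokens_def carries_def turing_machine_def)

lemma token_simps [simp]:
  "Sep \<in> tokens" "Return \<in> tokens" "Accept \<in> tokens" "Reject \<in> tokens"
  "Input a \<in> tokens \<longleftrightarrow> a \<in> \<Gamma>"
  "Cell s None c \<in> tokens \<longleftrightarrow> s \<in> symbols M \<and> c \<in> carries"
  "Cell s (Some q) c \<in> tokens \<longleftrightarrow> s \<in> symbols M \<and> q \<in> states M \<and> c \<in> carries"
  by (auto simp: tokens_def image_iff Bex_def)

lemma carry_simps [simp]:
  "Keep \<in> carries" "Final \<in> carries"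
  "Put_Head q \<in> carries \<longleftrightarrow> q \<in> states M" "Push s \<in> carries \<longleftrightarrow> s \<in> symbols M"
  by (auto simp: carries_def)

lemma M_facts:
  "Blank \<in> symbols M" "a \<in> \<Gamma> \<Longrightarrow> Letter a \<in> symbols M" "start_state M \<in> states M"
  "accept_state M \<in> states M" "reject_state M \<in> states M" "accept_state M \<noteq> reject_state M"
  using M by (auto simp: turing_machine_def)

lemma delta_closed:
  assumes "q \<in> states M" "\<not> halting q" "s \<in> symbols M" "delta M q s = (q', s', mv)"
  shows "q' \<in> states M" "s' \<in> symbols M"
proof -
  have "delta M q s \<in> states M \<times> symbols M \<times> UNIV"
    using M assms(1-3) by (auto simp: turing_machine_def halting_def)
  then show "q' \<in> states M" "s' \<in> symbols M" using assms(4) by auto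
qed

text \<open>The carries \<open>cr\<close> are left open: they matter only within the round that
  generates them. \<open>lo\<close> is the cell of the first token and decreases when the segment
  grows to the left.\<close>

definition represents :: "'g token list \<Rightarrow> int \<Rightarrow> 'g config \<Rightarrow> bool" where
  "represents x lo c \<longleftrightarrow>
     state_of c \<in> states M \<and> range (tape_of c) \<subseteq> symbols M \<and> set x \<subseteq> tokens \<and>
     (\<forall>k < length x. \<exists>cr. x ! k =
        Cell (tape_of c (lo + int k)) (if lo + int k = head_of c then Some (state_of c) else None) cr) \<and>
     lo \<le> head_of c \<and> head_of c < lo + int (length x) \<and>
     (\<forall>i. i < lo \<or> lo + int (length x) \<le> i \<longrightarrow> tape_of c i = Blank)"

text \<open>\<open>y\<close> can be generated after the context \<open>x @ [Sep]\<close>, and \<open>t\<close> is the token that follows it.\<close>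

definition derives :: "'g token list \<Rightarrow> 'g token list \<Rightarrow> 'g token \<Rightarrow> bool" where
  "derives x y t \<longleftrightarrow>
     (\<forall>k \<le> length y. rule ((Sep # y) ! k) ((x @ [Sep] @ y) ! k)
        ((x @ [Sep] @ y) ! (k + 1)) = (y @ [t]) ! k)"


lemma derivesI:
  assumes "\<And>k. k < length y \<Longrightarrow>
      rule ((Sep # y) ! k) ((x @ [Sep] @ y) ! k) ((x @ [Sep] @ y) ! (k + 1)) = y ! k"
    and "rule ((Sep # y) ! length y) ((x @ [Sep] @ y) ! length y) ((x @ [Sep] @ y) ! (length y + 1)) = t"
  shows "derives x y t"
  unfolding derives_def
proof (intro allI impI)
  fix k assume "k \<le> length y"
  then consider "k < length y" | "k = length y" by linarith
  then show "rule ((Sep # y) ! k) ((x @ [Sep] @ y) ! k) ((x @ [Sep] @ y) ! (k + 1)) = (y @ [t]) ! k"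
    by cases (use assms in \<open>auto simp: nth_append\<close>)
qed

text \<open>The first round makes no machine step. It turns the prompt into cells and puts the head
  on the cell generated right after \<open>Sep\<close>.\<close>

lemma derives_input:
  assumes w: "w \<in> lists \<Gamma>" "w \<noteq> []"
  shows "\<exists>y. derives (map Input w) y Return \<and> represents y 0 (initial_config M w) \<and>
    length y = length w"
proof -
  define y where "y = map (\<lambda>k. Cell (Letter (w ! k)) (if k = 0 then Some (start_state M) else None) Keep)
    [0..<length w]"
  have len: "length y = length w" by (simp add: y_def)
  have yk: "y ! k = Cell (Letter (w ! k)) (if k = 0 then Some (start_state M) else None) Keep"
    if "k < length w" for k using that by (simp add: y_def)
  have wk: "w ! k \<in> \<Gamma>" if "k < length w" for k using w that by (auto simp: in_lists_conv_set)
  have Keep: "carry_of ((Sep # y) ! k) = Keep" if "k \<le> length w" for k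
    using that by (cases k) (auto simp: y_def)
  have ne_Sep: "(Sep # y) ! k = Sep \<longleftrightarrow> k = 0" if "k \<le> length w" for k
    using that by (cases k) (auto simp: y_def)
  have "derives (map Input w) y Return"
  proof (rule derivesI)
    fix k assume k: "k < length y"
    then have "(map Input w @ [Sep] @ y) ! k = Input (w ! k)" by (simp add: nth_append len)
    then show "rule ((Sep # y) ! k) ((map Input w @ [Sep] @ y) ! k)
        ((map Input w @ [Sep] @ y) ! (k + 1)) = y ! k"
      using k Keep[of k] ne_Sep[of k] yk[of k] by (simp add: rule_def len)
  next
    show "rule ((Sep # y) ! length y) ((map Input w @ [Sep] @ y) ! length y)
        ((map Input w @ [Sep] @ y) ! (length y + 1)) = Return"
      using Keep[of "length w"] by (simp add: rule_def len nth_append)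
  qed
  moreover have "represents y 0 (initial_config M w)"
    using w wk M_facts
    by (auto simp: represents_def initial_config_def state_of_def tape_of_def head_of_def y_def
        split: if_splits)
  ultimately show ?thesis using len by blast
qed

lemma represents_nth:
  assumes "represents x lo c" "k < length x"
  obtains cr where "x ! k =
    Cell (tape_of c (lo + int k)) (if lo + int k = head_of c then Some (state_of c) else None) cr"
  using assms unfolding represents_def by blast

text \<open>The cells to the left of the head are copied, since \<open>rule\<close> does not apply
  \<open>delta\<close> to a halting neighbour. The verdict appears in place of the head cell, in the
  middle of the round.\<close>

lemma derives_halted:
  assumes rep: "represents x lo c" and halt: "halted M c"
  shows "\<exists>y. derives x y (if state_of c = accept_state M then Accept else Reject) \<and>
    set y \<subseteq> tokens - {Sep, Return, Accept, Reject} \<and> length y \<le> length x"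
proof -
  define m where "m = nat (head_of c - lo)"
  have m: "m < length x" "lo + int m = head_of c"
    using rep by (auto simp: m_def represents_def)
  define y where "y = map (\<lambda>k. Cell (tape_of c (lo + int k)) None Keep) [0..<m]"
  have len: "length y = m" by (simp add: y_def)
  have Keep: "carry_of ((Sep # y) ! k) = Keep" if "k \<le> m" for k
    using that by (cases k) (auto simp: y_def)
  have "derives x y (if state_of c = accept_state M then Accept else Reject)"
  proof (rule derivesI)
    fix k assume k: "k < length y"
    obtain cr where 1: "x ! k = Cell (tape_of c (lo + int k)) None cr"
      using represents_nth[OF rep, of k] k m by (auto simp: len split: if_splits)
    obtain cr' where 2: "x ! (k + 1) = Cell (tape_of c (lo + int (k + 1)))
        (if lo + int (k + 1) = head_of c then Some (state_of c) else None) cr'"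
      using represents_nth[OF rep, of "k + 1"] k m by (auto simp: len)
    show "rule ((Sep # y) ! k) ((x @ [Sep] @ y) ! k) ((x @ [Sep] @ y) ! (k + 1)) = y ! k"
      using k 1 2 Keep[of k] m halt
      by (simp add: rule_def len nth_append halting_def halted_def) (auto simp add: y_def)
  next
    obtain cr where 1: "x ! m = Cell (tape_of c (lo + int m)) (Some (state_of c)) cr"
      using represents_nth[OF rep, of m] m by auto
    show "rule ((Sep # y) ! length y) ((x @ [Sep] @ y) ! length y)
        ((x @ [Sep] @ y) ! (length y + 1)) =
        (if state_of c = accept_state M then Accept else Reject)"
      using 1 Keep[of m] m halt by (auto simp: rule_def len nth_append halted_def)
  qed
  moreover have "set y \<subseteq> tokens - {Sep, Return, Accept, Reject}"
    using rep by (auto simp: y_def represents_def image_subset_iff)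
  moreover have "length y \<le> length x" using m len by simp
  ultimately show ?thesis by blast
qed

lemma tm_step_unfold:
  assumes "\<not> halted M c" "delta M (state_of c) (tape_of c (head_of c)) = (q', s', mv)"
  shows "tm_step M c = (q', (tape_of c)(head_of c := s'), move_head mv (head_of c))"
  using assms by (simp add: tm_step_def)

text \<open>A right move reaches the next position through a carry. A left move must show one
  position before the old head, which is what the look-ahead token is for. The final inclusion says
  that growth only adds the cell just entered by the head; the space bound rests on it.\<close>

lemma derives_step:
  assumes rep: "represents x lo c" and run: "\<not> halted M c"
  shows "\<exists>y lo'. derives x y Return \<and> represents y lo' (tm_step M c) \<and>
    {lo'..<lo' + int (length y)} \<subseteq> {lo..<lo + int (length x)} \<union> {head_of (tm_step M c)}"
proof -
  define q tp h N where "q = state_of c" and "tp = tape_of c" and "h = head_of c" and "N = length x"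
  obtain q' s' mv where delta: "delta M q (tp h) = (q', s', mv)" by (cases "delta M q (tp h)")
  define tp' h' where "tp' = tp(h := s')" and "h' = move_head mv h"
  have step: "tm_step M c = (q', tp', h')"
    using tm_step_unfold[OF run] delta by (simp add: q_def tp_def h_def tp'_def h'_def)
  have nonhalt: "\<not> halting q" "q \<noteq> accept_state M" "q \<noteq> reject_state M"
    using run by (auto simp: halting_def halted_def q_def)
  have h: "lo \<le> h" "h < lo + int N" and N: "0 < N"
    and outside: "\<And>i. i < lo \<or> lo + int N \<le> i \<Longrightarrow> tp i = Blank"
    and syms: "\<And>i. tp i \<in> symbols M" and q: "q \<in> states M"
    using rep by (auto simp: represents_def h_def N_def tp_def q_def)
  have closed: "q' \<in> states M" "s' \<in> symbols M"
    using delta_closed[OF q nonhalt(1) syms delta] by auto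
  have syms': "tp' i \<in> symbols M" for i using syms closed by (simp add: tp'_def)
  have xk: "\<exists>cr. x ! k = Cell (tp (lo + int k)) (if lo + int k = h then Some q else None) cr"
    if "k < N" for k
    using represents_nth[OF rep, of k] that by (metis N_def h_def q_def tp_def)
  show ?thesis
  proof (cases "mv = MoveLeft \<and> h = lo")
    case True
    \<comment> \<open>The head leaves on the left. A blank cell is put in front, each position
      writes the pushed symbol and pushes its own, and the last symbol lands where
      \<open>Sep\<close> is read.\<close>
    define y where "y = map (\<lambda>k. Cell (tp' (lo - 1 + int k)) (if k = 0 then Some q' else None)
      (if k = N then Final else Push (tp' (lo + int k)))) [0..<N + 1]"
    have len: "length y = N + 1" by (simp add: y_def)
    have yk: "y ! k = Cell (tp' (lo - 1 + int k)) (if k = 0 then Some q' else None)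
      (if k = N then Final else Push (tp' (lo + int k)))" if "k \<le> N" for k
      using that by (simp add: y_def nth_append del: upt_Suc)
    have blank: "tp' (lo - 1) = Blank" "tp' (lo + int N) = Blank"
      using outside h by (auto simp: tp'_def)
    have "derives x y Return"
    proof (rule derivesI)
      fix k assume k: "k < length y"
      consider "k = 0" | "0 < k" "k < N" | "k = N" using k len by fastforce
      then show "rule ((Sep # y) ! k) ((x @ [Sep] @ y) ! k) ((x @ [Sep] @ y) ! (k + 1)) = y ! k"
      proof cases
        case 1
        obtain cr where "x ! 0 = Cell (tp h) (Some q) cr" using xk[OF N] True by auto
        then show ?thesis
          using 1 N True nonhalt delta blank yk[of 0]
          by (simp add: rule_def nth_append tp'_def flip: N_def)
      next
        case 2
        obtain cr where "x ! k = Cell (tp (lo + int k)) None cr" using xk[OF 2(2)] True 2 by auto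
        moreover have "k - 1 \<noteq> N" "lo - 1 + int k = lo + int (k - 1)"
          using 2 by auto
        moreover have "tp (lo - 1 + int k) = tp (lo + (int k - 1))"
          by (rule arg_cong[where f = tp]) simp
        ultimately show ?thesis
          using 2 True yk[of k] yk[of "k - 1"]
          by (simp add: rule_def nth_append tp'_def nth_Cons' flip: N_def)
      next
        case 3
        have "N - 1 \<noteq> N" using N by auto
        moreover have "tp' (lo - 1 + int N) = tp' (lo + (int N - 1))"
          by (rule arg_cong[where f = tp']) simp
        ultimately show ?thesis
          using 3 N yk[of N] yk[of "N - 1"]
          by (simp add: rule_def nth_append nth_Cons' flip: N_def)
      qed
    next
      \<comment> \<open>In a grown segment the old token at this index is already the first new
        cell, so the end is recognised by the carry \<open>Final\<close> instead of by
        \<open>Sep\<close>.\<close>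
      show "rule ((Sep # y) ! length y) ((x @ [Sep] @ y) ! length y)
          ((x @ [Sep] @ y) ! (length y + 1)) = Return"
        using yk[of N] by (simp add: rule_def len)
    qed
    moreover have "represents y (lo - 1) (tm_step M c)"
      unfolding represents_def step state_of_def tape_of_def head_of_def fst_conv snd_conv len
    proof (intro conjI allI impI)
      show "set y \<subseteq> tokens" using closed syms' by (auto simp: y_def simp del: upt_Suc)
      show "\<exists>cr. y ! k = Cell (tp' (lo - 1 + int k)) (if lo - 1 + int k = h' then Some q' else None) cr"
        if "k < N + 1" for k
        using that yk[of k] True by (auto simp: h'_def)
      show "tp' i = Blank" if "i < lo - 1 \<or> lo - 1 + int (N + 1) \<le> i" for i
        using that outside[of i] h by (auto simp: tp'_def)
    qed (use closed syms' True in \<open>auto simp: h'_def\<close>)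
    moreover have "{lo - 1..<lo - 1 + int (length y)} \<subseteq> {lo..<lo + int (length x)} \<union> {head_of (tm_step M c)}"
      using True by (auto simp: len step head_of_def h'_def N_def)
    ultimately show ?thesis by blast
  next
    case False
    \<comment> \<open>The left end stays, and one cell is added exactly if the head moves right from
      the last one.\<close>
    define N' where "N' = (if mv = MoveRight \<and> h = lo + int N - 1 then N + 1 else N)"
    define y where "y = map (\<lambda>k. Cell (tp' (lo + int k)) (if lo + int k = h' then Some q' else None)
      (if k = N then Final else if mv = MoveRight \<and> lo + int k = h then Put_Head q' else Keep)) [0..<N']"
    have len: "length y = N'" by (simp add: y_def)
    have N': "N \<le> N'" "N' \<le> N + 1" by (auto simp: N'_def)
    have yk: "y ! k = Cell (tp' (lo + int k)) (if lo + int k = h' then Some q' else None)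
      (if k = N then Final else if mv = MoveRight \<and> lo + int k = h then Put_Head q' else Keep)"
      if "k < N'" for k
      using that by (simp add: y_def nth_append del: upt_Suc)
    have carry: "carry_of ((Sep # y) ! k) =
        (if mv = MoveRight \<and> lo + int k = h + 1 then Put_Head q' else Keep)" if "k \<le> N" for k
      using that N' h yk[of "k - 1"] by (cases k) auto
    have ne_Sep: "(Sep # y) ! k = Sep \<longleftrightarrow> k = 0" if "k \<le> N'" for k
      using that yk[of "k - 1"] by (cases k) auto
    have inner: "rule ((Sep # y) ! k) ((x @ [Sep] @ y) ! k) ((x @ [Sep] @ y) ! (k + 1)) = y ! k"
      if k: "k < N" for k
    proof -
      obtain cr where x: "x ! k = Cell (tp (lo + int k)) (if lo + int k = h then Some q else None) cr"
        using xk[OF k] by blast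
      have y: "y ! k = Cell (tp' (lo + int k)) (if lo + int k = h' then Some q' else None)
          (if mv = MoveRight \<and> lo + int k = h then Put_Head q' else Keep)"
        using yk[of k] k N' by simp
      have nx: "(x @ [Sep] @ y) ! k = x ! k" using k by (simp add: nth_append N_def)
      have car: "carry_of ((Sep # y) ! k) =
        (if mv = MoveRight \<and> lo + int k = h + 1 then Put_Head q' else Keep)"
        using carry k by simp
      show ?thesis
      proof (cases "lo + int k = h")
        case True
        \<comment> \<open>A left move from the first cell belongs to the other case, so the
          inserting branch of \<open>rule\<close> is not taken.\<close>
        have notSep: "mv = MoveLeft \<Longrightarrow> (Sep # y) ! k \<noteq> Sep"
          using ne_Sep[of k] k N' True False by auto
        show ?thesis
          using x y car nonhalt delta True notSep unfolding nx
          by (cases mv) (simp_all add: rule_def tp'_def h'_def)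
      next
        case off: False
        show ?thesis
        proof (cases "mv = MoveRight \<and> lo + int k = h + 1")
          case True
          then show ?thesis using x y car off unfolding nx
            by (simp add: rule_def tp'_def h'_def)
        next
          case nocarry: False
          show ?thesis
          proof (cases "k + 1 < N")
            case True
            obtain cr' where x': "x ! (k + 1) = Cell (tp (lo + int (k + 1)))
                (if lo + int (k + 1) = h then Some q else None) cr'"
              using xk[OF True] by blast
            have nx': "(x @ [Sep] @ y) ! (k + 1) = x ! (k + 1)"
              using True by (simp add: nth_append N_def)
            show ?thesis
            proof (cases "lo + int (k + 1) = h")
              case True
              \<comment> \<open>The head is on the right neighbour, and the look-ahead decides
                whether it moves onto this cell.\<close>
              then have "x ! (k + 1) = Cell (tp h) (Some q) cr'" "lo + int k = h - 1"
                using x' by auto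
              then show ?thesis
                using x y car nocarry nonhalt delta unfolding nx nx'
                by (cases mv) (auto simp add: rule_def tp'_def h'_def)
            next
              case False
              then show ?thesis
                using x y car off nocarry x' unfolding nx nx'
                by (cases mv) (auto simp add: rule_def tp'_def h'_def)
            qed
          next
            case last: False
            then have "(x @ [Sep] @ y) ! (k + 1) = Sep"
              using k by (simp add: nth_append N_def)
            moreover have "lo + int k \<noteq> h'"
              using last k h off nocarry by (cases mv) (auto simp: h'_def)
            ultimately show ?thesis
              using x y car off nocarry unfolding nx by (auto simp: rule_def tp'_def)
          qed
        qed
      qed
    qed
    have "derives x y Return"
    proof (cases "N' = N")
      case True
      then have "\<not> (mv = MoveRight \<and> lo + int N = h + 1)" by (auto simp: N'_def split: if_splits)
      then have "carry_of ((Sep # y) ! N) = Keep" using carry[of N] by simp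
      then have "rule ((Sep # y) ! N) ((x @ [Sep] @ y) ! N) ((x @ [Sep] @ y) ! (N + 1)) = Return"
        by (simp add: rule_def nth_append N_def)
      then show ?thesis
        using inner by (intro derivesI) (simp_all only: len True)
    next
      case grow: False
      then have R: "mv = MoveRight" "lo + int N = h + 1" and N'': "N' = N + 1"
        by (auto simp: N'_def split: if_splits)
      have car: "carry_of ((Sep # y) ! N) = Put_Head q'" using carry[of N] R by simp
      have "tp' (h + 1) = Blank" using outside[of "h + 1"] R by (simp add: tp'_def)
      then have yN: "y ! N = Cell Blank (Some q') Final"
        using yk[of N] N'' R by (simp add: h'_def)
      show ?thesis
      proof (rule derivesI)
        fix k assume "k < length y"
        then consider "k < N" | "k = N" using len N'' by linarith
        then show "rule ((Sep # y) ! k) ((x @ [Sep] @ y) ! k) ((x @ [Sep] @ y) ! (k + 1)) = y ! k"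
        proof cases
          case 2
          then show ?thesis using car yN by (simp add: rule_def nth_append flip: N_def)
        qed (rule inner)
      next
        show "rule ((Sep # y) ! length y) ((x @ [Sep] @ y) ! length y)
          ((x @ [Sep] @ y) ! (length y + 1)) = Return"
          using yN by (simp add: rule_def len N'')
      qed
    qed
    moreover have "represents y lo (tm_step M c)"
      unfolding represents_def step state_of_def tape_of_def head_of_def fst_conv snd_conv len
    proof (intro conjI allI impI)
      show "set y \<subseteq> tokens" using closed syms' by (auto simp: y_def simp del: upt_Suc)
      show "\<exists>cr. y ! k = Cell (tp' (lo + int k)) (if lo + int k = h' then Some q' else None) cr"
        if "k < N'" for k
        using yk[OF that] by blast
      show "tp' i = Blank" if "i < lo \<or> lo + int N' \<le> i" for i
        using that outside[of i] h N' by (auto simp: tp'_def)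
      show "lo \<le> h'" using h False by (cases mv) (auto simp: h'_def)
      show "h' < lo + int N'" using h by (cases mv) (auto simp: h'_def N'_def)
    qed (use closed syms' in auto)
    moreover have "{lo..<lo + int (length y)} \<subseteq> {lo..<lo + int (length x)} \<union> {head_of (tm_step M c)}"
      by (auto simp: len step head_of_def h'_def N'_def N_def[symmetric])
    ultimately show ?thesis by blast
  qed
qed

section \<open>Tokens as numbers and rounds of the generator\<close>

definition code :: "'g token \<Rightarrow> nat" where
  "code = (SOME e. bij_betw e tokens {..<card tokens})"

lemma bij_code: "bij_betw code tokens {..<card tokens}"
proof -
  have "\<exists>e. bij_betw e tokens {..<card tokens}"
    using ex_bij_betw_finite_nat[OF finite_tokens] by (simp add: atLeast0LessThan)
  then show ?thesis unfolding code_def by (rule someI_ex)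
qed

lemma code_less [simp]: "t \<in> tokens \<Longrightarrow> code t < card tokens"
  using bij_code by (auto dest: bij_betwE)

lemma code_eq_iff [simp]: "t \<in> tokens \<Longrightarrow> t' \<in> tokens \<Longrightarrow> code t = code t' \<longleftrightarrow> t = t'"
  using bij_code by (auto simp: bij_betw_def inj_on_def)

lemma code_mem_image [simp]: "t \<in> tokens \<Longrightarrow> A \<subseteq> tokens \<Longrightarrow> code t \<in> code ` A \<longleftrightarrow> t \<in> A"
  using code_eq_iff by blast

definition decode :: "nat \<Rightarrow> 'g token" where
  "decode = the_inv_into tokens code"

lemma decode_code [simp]: "t \<in> tokens \<Longrightarrow> decode (code t) = t"
  using bij_code by (simp add: decode_def bij_betw_def the_inv_into_f_f)

text \<open>The default \<open>Sep\<close> is never used in a run.\<close>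

definition coded_rule :: "nat \<Rightarrow> nat \<Rightarrow> nat \<Rightarrow> nat" where
  "coded_rule a b c =
     (let t = rule (decode a) (decode b) (decode c) in if t \<in> tokens then code t else code Sep)"

sublocale tr: token_rule "card tokens" "code Sep" coded_rule
  by unfold_locales (auto simp: coded_rule_def Let_def)

abbreviation V :: "nat set" where "V \<equiv> {..<card tokens}"
abbreviation generator :: "nat list \<Rightarrow> nat" where
  "generator \<equiv> next_token V tr.rule_transformer"
abbreviation reduce :: "nat list \<Rightarrow> nat list" where
  "reduce \<equiv> pencil_reduce (code Sep) (code Return)"

definition unambiguous :: "nat list \<Rightarrow> bool" where
  "unambiguous y \<longleftrightarrow> y \<noteq> [] \<and> (\<exists>!a. is_arg_max (logit tr.rule_transformer y) (\<lambda>a. a \<in> V) a)"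

lemma generator_no_sep:
  assumes "set x \<subseteq> tokens" "x \<noteq> []" "Sep \<notin> set x"
  shows "generator (map code x) = code Sep" "unambiguous (map code x)"
proof -
  have logit: "logit tr.rule_transformer (map code x) a = of_bool (a = code Sep)"
    if "a < card tokens" for a
    using assms that by (intro tr.logit_no_sep) (auto intro!: code_less)
  show "generator (map code x) = code Sep" "unambiguous (map code x)"
    using tr.next_token_of_bool_logit[OF _ logit] assms(2) by (auto simp: unambiguous_def)
qed

lemma generator_sep:
  assumes y: "set y \<subseteq> tokens" "y \<noteq> []" "Sep \<notin> set y" and z: "set z \<subseteq> tokens" "Sep \<notin> set z"
    and t: "rule ((Sep # z) ! length z) ((y @ [Sep] @ z) ! length z) ((y @ [Sep] @ z) ! (length z + 1)) = t"
      "t \<in> tokens"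
  shows "generator (map code (y @ [Sep] @ z)) = code t" "unambiguous (map code (y @ [Sep] @ z))"
proof -
  let ?x = "y @ [Sep] @ z"
  have x: "set ?x \<subseteq> tokens" using y z by auto
  have len: "length z + 1 < length ?x" using y(2) by (auto simp: Suc_lessI)
  have mem: "?x ! length z \<in> tokens" "?x ! (length z + 1) \<in> tokens"
    using x nth_mem[of "length z" ?x] nth_mem[of "length z + 1" ?x] len by auto
  have lst: "last ?x = (Sep # z) ! length z" by (simp add: last_conv_nth)
  have lst_mem: "(Sep # z) ! length z \<in> tokens" using nth_mem[of "length z" "Sep # z"] z by auto
  have lists: "map code y \<in> lists V" "map code z \<in> lists V"
    using y(1) z(1) by (auto simp: in_lists_conv_set)
  have "map code ?x = map code y @ [code Sep] @ map code z" by simp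
  moreover have "last (map code ?x) = code ((Sep # z) ! length z)"
    using lst by (metis append_is_Nil_conv last_map y(2))
  moreover have "map code ?x ! length (map code z) = code (?x ! length z)"
    "map code ?x ! (length (map code z) + 1) = code (?x ! (length z + 1))"
    using len by (simp_all only: length_map nth_map)
  ultimately have logit: "logit tr.rule_transformer (map code ?x) a = of_bool (a = code t)"
    if "a < card tokens" for a
    using tr.logit_sep[of "map code y" "map code z" a] lists y z that t mem lst_mem
    by (auto simp: coded_rule_def simp del: map_append append.simps)
  show "generator (map code ?x) = code t" "unambiguous (map code ?x)"
    using tr.next_token_of_bool_logit[OF _ logit] t(2) by (auto simp: unambiguous_def)
qed

definition continues :: "nat \<Rightarrow> nat list \<Rightarrow> bool" where
  "continues B y \<longleftrightarrow> generator y \<notin> {code Accept, code Reject} \<and> unambiguous y \<and> length y < B"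

definition steps_to :: "nat \<Rightarrow> nat list \<Rightarrow> nat list \<Rightarrow> bool" where
  "steps_to B y y' \<longleftrightarrow> continues B y \<and> y' = reduce (append_next generator y)"

text \<open>The process is deterministic, so a chain of \<open>steps_to\<close> is an initial part
  of the context sequence. This turns separately proved rounds into a statement about all contexts
  met on the way.\<close>

lemma context_seq_of_steps:
  assumes "(steps_to B)\<^sup>*\<^sup>* y y'"
  shows "\<exists>J. context_seq reduce generator y J = y' \<and>
    (\<forall>j < J. continues B (context_seq reduce generator y j))"
  using assms
proof induction
  case base
  show ?case by (rule exI[of _ 0]) (simp add: context_seq_def)
next
  case (step u v)
  then obtain J where J: "context_seq reduce generator y J = u"
    "\<forall>j < J. continues B (context_seq reduce generator y j)" by blast
  have "context_seq reduce generator y (Suc J) = v"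
    using J(1) step(2) by (simp add: context_seq_def steps_to_def)
  moreover have "\<forall>j < Suc J. continues B (context_seq reduce generator y j)"
    using J step(2) by (auto simp: less_Suc_eq steps_to_def)
  ultimately show ?case by blast
qed

lemma steps_to_append:
  assumes "generator (map code x) = code t" "unambiguous (map code x)" "length x < B"
    and "t \<in> tokens - {Return, Accept, Reject}"
  shows "steps_to B (map code x) (map code (x @ [t]))"
  using assms pencil_reduce_other[of "code t" "code Return" "code Sep" "map code x"]
  by (simp add: steps_to_def continues_def append_next_def)

context
  fixes x y :: "'g token list" and t :: "'g token" and B :: nat
  assumes derives: "derives x y t" and x: "x \<noteq> []" "set x \<subseteq> tokens - {Sep}"
    and y: "set y \<subseteq> tokens - {Sep, Return, Accept, Reject}" and t: "t \<in> tokens"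
    and B: "length x + length y + 1 < B"
begin

text \<open>\<open>derives\<close> reads the completed context, the generator only a prefix. Since
  \<open>x\<close> is nonempty, the indices \<open>k\<close> and \<open>k + 1\<close> already lie in
  the prefix of length \<open>length x + 1 + k\<close>.\<close>

lemma generator_derives:
  assumes k: "k \<le> length y"
  shows "generator (map code (x @ [Sep] @ take k y)) = code ((y @ [t]) ! k)"
    "unambiguous (map code (x @ [Sep] @ take k y))"
proof -
  have 0: "0 < length x" using x by simp
  have "(x @ [Sep] @ take k y) ! k = (x @ [Sep] @ y) ! k"
    "(x @ [Sep] @ take k y) ! (k + 1) = (x @ [Sep] @ y) ! (k + 1)"
    using 0 by (auto simp: nth_append nth_Cons' simp del: length_greater_0_conv)
  moreover have "(Sep # take k y) ! k = (Sep # y) ! k" using k by (cases k) auto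
  ultimately have "rule ((Sep # take k y) ! k) ((x @ [Sep] @ take k y) ! k)
      ((x @ [Sep] @ take k y) ! (k + 1)) = (y @ [t]) ! k"
    using derives k by (simp add: derives_def)
  moreover have "(y @ [t]) ! k \<in> tokens"
    using k y t nth_mem[of k "y @ [t]"] by auto
  moreover have "set (take k y) \<subseteq> tokens - {Sep}" using set_take_subset[of k y] y by auto
  ultimately show "generator (map code (x @ [Sep] @ take k y)) = code ((y @ [t]) ! k)"
    "unambiguous (map code (x @ [Sep] @ take k y))"
    using generator_sep[of x "take k y"] x k by (auto simp: min_absorb2 subset_Diff_insert)
qed

lemma steps_to_generated: "(steps_to B)\<^sup>*\<^sup>* (map code x) (map code (x @ [Sep] @ y))"
proof -
  have "(steps_to B)\<^sup>*\<^sup>* (map code x) (map code (x @ [Sep] @ take k y))" if "k \<le> length y" for k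
    using that
  proof (induction k)
    case 0
    have "steps_to B (map code x) (map code (x @ [Sep]))"
      using generator_no_sep[of x] x B by (intro steps_to_append) auto
    then show ?case by simp
  next
    case (Suc k)
    then have "y ! k \<in> set y" by simp
    then have "y ! k \<in> tokens - {Return, Accept, Reject}" using y by blast
    then have "steps_to B (map code (x @ [Sep] @ take k y)) (map code ((x @ [Sep] @ take k y) @ [y ! k]))"
      using generator_derives[of k] Suc B by (intro steps_to_append) (auto simp: nth_append)
    moreover have "(x @ [Sep] @ take k y) @ [y ! k] = x @ [Sep] @ take (Suc k) y"
      using Suc by (simp add: take_Suc_conv_app_nth)
    ultimately show ?case using Suc by (metis Suc_leD rtranclp.rtrancl_into_rtrancl)
  qed
  from this[of "length y"] show ?thesis by simp
qed

lemma steps_to_reduced: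
  assumes "t = Return"
  shows "(steps_to B)\<^sup>*\<^sup>* (map code x) (map code y)"
proof -
  let ?u = "map code (x @ [Sep] @ y)"
  have g: "generator ?u = code Return" "unambiguous ?u"
    using generator_derives[of "length y"] assms by auto
  have "reduce (append_next generator ?u) = map code y"
  proof -
    have "code Sep \<notin> set (map code y)" "code Return \<notin> set (map code y)"
      using y by (auto simp: image_iff)
    then show ?thesis
      using pencil_reduce_return[of "code Sep" "map code y" "code Return" "map code x"] g
      by (simp add: append_next_def)
  qed
  then have "steps_to B ?u (map code y)"
    using g B by (simp add: steps_to_def continues_def)
  with steps_to_generated show ?thesis by (rule rtranclp.rtrancl_into_rtrancl)
qed

end

section \<open>Whole runs within the space bound\<close>

lemma represents_set:
  assumes "represents x lo c"
  shows "x \<noteq> []" "set x \<subseteq> tokens - {Sep, Return, Accept, Reject}"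
proof -
  show "x \<noteq> []" using assms by (auto simp: represents_def)
  show "set x \<subseteq> tokens - {Sep, Return, Accept, Reject}"
  proof
    fix a assume a: "a \<in> set x"
    then obtain k where k: "k < length x" "a = x ! k" by (auto simp: in_set_conv_nth)
    then show "a \<in> tokens - {Sep, Return, Accept, Reject}"
      using assms a represents_nth[OF assms k(1)] by (metis Diff_iff empty_iff insert_iff
          represents_def subsetD token.distinct(11) token.distinct(13) token.distinct(15) token.distinct(17))
  qed
qed

text \<open>The segment is an interval inside the input cells and visited cells, so it has at most
  \<open>n\<close> tokens however many steps have been made. Before a reduction, two segments and
  the separator take at most \<open>2 * n + 1\<close> tokens.\<close>

lemma steps_to_config:
  fixes w
  defines "n \<equiv> length w + card (visited_cells M w)"
  assumes w: "w \<in> lists \<Gamma>" "w \<noteq> []" and B: "2 * n + 2 < B"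
    and fin: "finite (visited_cells M w)" and T: "\<forall>t < T. \<not> halted M (config_after M w t)"
  shows "t \<le> T \<Longrightarrow> \<exists>x lo. represents x lo (config_after M w t) \<and> length x \<le> n \<and>
    {lo..<lo + int (length x)} \<subseteq> {0..<int (length w)} \<union> visited_cells M w \<and>
    (steps_to B)\<^sup>*\<^sup>* (map code (map Input w)) (map code x)"
proof (induction t)
  case 0
  obtain y where y: "derives (map Input w) y Return" "represents y 0 (initial_config M w)"
    "length y = length w" using derives_input[OF w] by blast
  have "(steps_to B)\<^sup>*\<^sup>* (map code (map Input w)) (map code y)"
    using w B y represents_set[OF y(2)] by (intro steps_to_reduced) (auto simp: n_def)
  then show ?case using y by (intro exI[of _ y] exI[of _ 0]) (auto simp: config_after_def n_def)
next
  case (Suc t)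
  then obtain x lo where x: "represents x lo (config_after M w t)" "length x \<le> n"
    "{lo..<lo + int (length x)} \<subseteq> {0..<int (length w)} \<union> visited_cells M w"
    "(steps_to B)\<^sup>*\<^sup>* (map code (map Input w)) (map code x)" by auto
  have c: "config_after M w (Suc t) = tm_step M (config_after M w t)"
    by (simp add: config_after_def)
  obtain y lo' where y: "derives x y Return" "represents y lo' (config_after M w (Suc t))"
    "{lo'..<lo' + int (length y)} \<subseteq> {lo..<lo + int (length x)} \<union> {head_of (config_after M w (Suc t))}"
    using derives_step[OF x(1)] T Suc.prems unfolding c by auto
  have "head_of (config_after M w (Suc t)) \<in> visited_cells M w"
    by (auto simp: visited_cells_def)
  then have sub: "{lo'..<lo' + int (length y)} \<subseteq> {0..<int (length w)} \<union> visited_cells M w"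
    using x(3) y(3) by auto
  have "card {lo'..<lo' + int (length y)} \<le> card ({0..<int (length w)} \<union> visited_cells M w)"
    using sub fin by (intro card_mono) auto
  also have "\<dots> \<le> n" using card_Un_le[of "{0..<int (length w)}" "visited_cells M w"] by (simp add: n_def)
  finally have len: "length y \<le> n" by simp
  have "(steps_to B)\<^sup>*\<^sup>* (map code x) (map code y)"
    using represents_set[OF x(1)] represents_set[OF y(2)] y(1) x(2) len B
    by (intro steps_to_reduced) auto
  then show ?case using x(4) y(2) sub len by (meson rtranclp_trans)
qed

lemma halting_run:
  assumes w: "w \<in> lists \<Gamma>" "w \<noteq> []" and dec: "decides_at M L w t0"
    and B: "2 * (length w + card (visited_cells M w)) + 2 < B"
  defines "ctx \<equiv> context_seq reduce generator (map (code \<circ> Input) w)"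
  shows "\<exists>J. halts_at {code Accept} {code Reject} reduce generator (map (code \<circ> Input) w) J \<and>
    (generator (ctx J) \<in> {code Accept} \<longleftrightarrow> w \<in> L) \<and>
    (\<forall>j \<le> J. unambiguous (ctx j) \<and> length (ctx j) < B)"
proof -
  define T where "T = (LEAST t. halted M (config_after M w t))"
  have t0: "halted M (config_after M w t0)" using dec by (simp add: decides_at_def)
  have T: "halted M (config_after M w T)" unfolding T_def using t0 by (rule LeastI)
  have T0: "T \<le> t0" unfolding T_def using t0 by (rule Least_le)
  have nT: "\<forall>t < T. \<not> halted M (config_after M w t)" unfolding T_def using not_less_Least by blast
  have verdict: "state_of (config_after M w T) = accept_state M \<longleftrightarrow> w \<in> L"
    using dec config_after_halted[OF T T0] by (simp add: decides_at_def)
  \<comment> \<open>An infinite set has \<open>card\<close> 0, so finiteness has to come before any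
    use of the space bound. The head stands still after \<open>T\<close>.\<close>
  have "visited_cells M w \<subseteq> (\<lambda>t. head_of (config_after M w t)) ` {..T}"
  proof -
    have "head_of (config_after M w t) = head_of (config_after M w (min t T))" for t
      using config_after_halted[OF T, of t] by (auto simp: min_def)
    then show ?thesis unfolding visited_cells_def by (metis (no_types, lifting) atMost_iff image_eqI
          image_subsetI min.cobounded2)
  qed
  then have fin: "finite (visited_cells M w)" using finite_subset by blast
  obtain x lo where x: "represents x lo (config_after M w T)"
    "length x \<le> length w + card (visited_cells M w)"
    "(steps_to B)\<^sup>*\<^sup>* (map code (map Input w)) (map code x)"
    using steps_to_config[OF w B fin nT, of T] by auto
  let ?t = "if state_of (config_after M w T) = accept_state M then Accept else Reject"
  obtain y where y: "derives x y ?t" "set y \<subseteq> tokens - {Sep, Return, Accept, Reject}"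
    "length y \<le> length x" using derives_halted[OF x(1) T] by blast
  let ?u = "map code (x @ [Sep] @ y)"
  have hyps: "derives x y ?t" "x \<noteq> []" "set x \<subseteq> tokens - {Sep}"
    "set y \<subseteq> tokens - {Sep, Return, Accept, Reject}" "?t \<in> tokens" "length x + length y + 1 < B"
    using represents_set[OF x(1)] y x(2) B by auto
  have g: "(steps_to B)\<^sup>*\<^sup>* (map code x) ?u" "generator ?u = code ?t" "unambiguous ?u"
    using steps_to_generated[OF hyps] generator_derives[OF hyps order_refl] by simp_all
  have "(steps_to B)\<^sup>*\<^sup>* (map (code \<circ> Input) w) ?u"
    using x(3) g(1) by (simp add: comp_def)
  then obtain J where J: "ctx J = ?u" "\<forall>j < J. continues B (ctx j)"
    unfolding ctx_def using context_seq_of_steps by blast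
  have "halts_at {code Accept} {code Reject} reduce generator (map (code \<circ> Input) w) J"
    using J g by (auto simp: halts_at_def ctx_def continues_def simp del: append.simps)
  moreover have "generator (ctx J) \<in> {code Accept} \<longleftrightarrow> w \<in> L"
    using J(1) g(2) verdict by auto
  moreover have "unambiguous (ctx j) \<and> length (ctx j) < B" if "j \<le> J" for j
  proof (cases "j = J")
    case True
    then show ?thesis using J(1) g(3) y(3) x(2) B by auto
  next
    case False
    then show ?thesis using J(2) that by (auto simp: continues_def)
  qed
  ultimately show ?thesis by blast
qed

lemma pencil_decides:
  fixes p :: "nat poly"
  assumes "\<forall>w \<in> lists \<Gamma>. (\<exists>t. decides_at M L w t) \<and> card (visited_cells M w) \<le> poly p (length w)"
  shows "pencil_vocabulary \<Gamma> V {code Accept} {code Reject} (code \<circ> Input) (code Sep) (code Return)"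
    and "well_defined_on_runs \<Gamma> V {code Accept} {code Reject} (code \<circ> Input) reduce tr.rule_transformer"
    and "process_decides \<Gamma> {code Accept} {code Reject} (code \<circ> Input) reduce generator L"
    and "poly_bounded_context \<Gamma> {code Accept} {code Reject} (code \<circ> Input) reduce generator"
proof -
  show "pencil_vocabulary \<Gamma> V {code Accept} {code Reject} (code \<circ> Input) (code Sep) (code Return)"
    by (auto simp: pencil_vocabulary_def vocabulary_def inj_on_def)
  let ?ctx = "\<lambda>w. context_seq reduce generator (map (code \<circ> Input) w)"
  let ?B = "\<lambda>w. 2 * (length w + poly p (length w)) + 3"
  have run: "\<exists>J. halts_at {code Accept} {code Reject} reduce generator (map (code \<circ> Input) w) J \<and>
    (generator (?ctx w J) \<in> {code Accept} \<longleftrightarrow> w \<in> L) \<and>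
    (\<forall>j \<le> J. unambiguous (?ctx w j) \<and> length (?ctx w j) < ?B w)"
    if w: "w \<in> lists \<Gamma>" "w \<noteq> []" for w
  proof -
    have "card (visited_cells M w) \<le> poly p (length w)" using assms w by blast
    then show ?thesis using assms w halting_run[OF w, of L _ "?B w"] by fastforce
  qed
  have good: "unambiguous (?ctx w j) \<and> length (?ctx w j) < ?B w"
    if "w \<in> lists \<Gamma>" "w \<noteq> []"
      "halts_at {code Accept} {code Reject} reduce generator (map (code \<circ> Input) w) J" "j \<le> J" for w J j
    using run[OF that(1,2)] halts_at_unique[OF that(3)] that(4) by blast
  show "well_defined_on_runs \<Gamma> V {code Accept} {code Reject} (code \<circ> Input) reduce tr.rule_transformer"
    using good by (auto simp: well_defined_on_runs_def unambiguous_def Let_def)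
  show "process_decides \<Gamma> {code Accept} {code Reject} (code \<circ> Input) reduce generator L"
    using run unfolding process_decides_def by blast
  show "poly_bounded_context \<Gamma> {code Accept} {code Reject} (code \<circ> Input) reduce generator"
    unfolding poly_bounded_context_def
  \<comment> \<open>This polynomial takes the value \<open>?B w\<close> at \<open>length w\<close>.
    The token just generated is covered because contexts are strictly shorter than
    \<open>?B w\<close>.\<close>
  proof (intro exI[of _ "[:3, 2:] + [:2:] * p"] ballI impI allI)
    fix w J
    assume w: "w \<in> lists \<Gamma>" "w \<noteq> []"
      and J: "halts_at {code Accept} {code Reject} reduce generator (map (code \<circ> Input) w) J"
    have "length (?ctx w j) < ?B w" if "j \<le> J" for j using good[OF w J that] by blast
    from this[of 0] this have "max_context_length reduce generator (map (code \<circ> Input) w) J \<le> ?B w"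
      unfolding max_context_length_def
      by (intro Max.boundedI) (auto simp: append_next_def context_seq_def Suc_le_eq)
    then show "max_context_length reduce generator (map (code \<circ> Input) w) J
        \<le> poly ([:3, 2:] + [:2:] * p) (length w)"
      by (simp add: algebra_simps)
  qed
qed

end

lemma pspace_pencil:
  assumes "finite \<Gamma>" "L \<in> class_PSPACE \<Gamma>"
  shows "\<exists>(V :: nat set) Acc Rej enc sep ret (\<theta> :: nat transformer).
           pencil_vocabulary \<Gamma> V Acc Rej enc sep ret \<and>
           is_transformer V \<theta> \<and>
           well_defined_on_runs \<Gamma> V Acc Rej enc (pencil_reduce sep ret) \<theta> \<and>
           process_decides \<Gamma> Acc Rej enc (pencil_reduce sep ret) (next_token V \<theta>) L \<and>
           poly_bounded_context \<Gamma> Acc Rej enc (pencil_reduce sep ret) (next_token V \<theta>)"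
proof -
  obtain M p where machine: "turing_machine \<Gamma> M"
    "\<forall>w \<in> lists \<Gamma>. (\<exists>t. decides_at M L w t) \<and> card (visited_cells M w) \<le> poly p (length w)"
    using assms(2) by (auto simp: class_PSPACE_def)
  interpret tm_pencil \<Gamma> M using assms(1) machine(1) by unfold_locales
  show ?thesis using pencil_decides[OF machine(2)] tr.is_transformer_rule by blast
qed

section \<open>Chain-of-Thought in polynomial time\<close>

definition machine_step ::
    "('s \<Rightarrow> 'a symbol \<Rightarrow> 's \<times> 'a symbol \<times> move) \<Rightarrow> 's set \<Rightarrow>
     's \<times> (int \<Rightarrow> 'a symbol) \<times> int \<Rightarrow> 's \<times> (int \<Rightarrow> 'a symbol) \<times> int" where
  "machine_step \<delta> H = (\<lambda>(s, tp, h). if s \<in> H then (s, tp, h) else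
     (case \<delta> s (tp h) of (s', b, m) \<Rightarrow> (s', tp(h := b), move_head m h)))"

definition input_tape :: "'a list \<Rightarrow> int \<Rightarrow> 'a symbol" where
  "input_tape w = (\<lambda>i. if 0 \<le> i \<and> i < int (length w) then Letter (w ! nat i) else Blank)"

lemma machine_step_eq:
  "s \<notin> H \<Longrightarrow> \<delta> s (tp h) = (s', b, m) \<Longrightarrow>
    machine_step \<delta> H (s, tp, h) = (s', tp(h := b), move_head m h)"
  by (simp add: machine_step_def)

lemma machine_step_halted: "s \<in> H \<Longrightarrow> machine_step \<delta> H (s, tp, h) = (s, tp, h)"
  by (simp add: machine_step_def)

lemma funpow_machine_step_halted: "s \<in> H \<Longrightarrow> (machine_step \<delta> H ^^ k) (s, tp, h) = (s, tp, h)"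
  by (induction k) (simp_all add: machine_step_halted)

lemma sweep_right:
  assumes "s \<notin> H" "\<And>i. h \<le> i \<Longrightarrow> i < h + int n \<Longrightarrow> \<delta> s (tp i) = (s, g i, MoveRight)"
  shows "(machine_step \<delta> H ^^ n) (s, tp, h)
    = (s, \<lambda>i. if h \<le> i \<and> i < h + int n then g i else tp i, h + int n)"
  using assms(2)
proof (induction n)
  case 0
  then show ?case by (auto intro!: ext)
next
  case (Suc n)
  then have "(machine_step \<delta> H ^^ n) (s, tp, h)
    = (s, \<lambda>i. if h \<le> i \<and> i < h + int n then g i else tp i, h + int n)" by simp
  then have "(machine_step \<delta> H ^^ Suc n) (s, tp, h) = machine_step \<delta> H
      (s, \<lambda>i. if h \<le> i \<and> i < h + int n then g i else tp i, h + int n)" by simp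
  also have "\<dots> = (s, \<lambda>i. if h \<le> i \<and> i < h + int (Suc n) then g i else tp i, h + int (Suc n))"
    using Suc.prems[of "h + int n"] assms(1) by (subst machine_step_eq) auto
  finally show ?case .
qed

lemma sweep_left:
  assumes "s \<notin> H" "\<And>i. h - int n < i \<Longrightarrow> i \<le> h \<Longrightarrow> \<delta> s (tp i) = (s, tp i, MoveLeft)"
  shows "(machine_step \<delta> H ^^ n) (s, tp, h) = (s, tp, h - int n)"
  using assms(2)
proof (induction n)
  case 0
  then show ?case by simp
next
  case (Suc n)
  then have "(machine_step \<delta> H ^^ Suc n) (s, tp, h) = machine_step \<delta> H (s, tp, h - int n)" by simp
  also have "\<dots> = (s, tp, h - int (Suc n))"
    using Suc.prems[of "h - int n"] assms(1) by (subst machine_step_eq) auto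
  finally show ?case .
qed

text \<open>An upper bound rather than an exact count, so that the cost of each phase can be rounded
  up before phases are chained.\<close>

definition reaches :: "('c \<Rightarrow> 'c) \<Rightarrow> nat \<Rightarrow> 'c \<Rightarrow> 'c \<Rightarrow> bool" where
  "reaches f n c c' \<longleftrightarrow> (\<exists>k \<le> n. (f ^^ k) c = c')"

lemma reaches_funpow: "(f ^^ k) c = c' \<Longrightarrow> k \<le> n \<Longrightarrow> reaches f n c c'"
  by (auto simp: reaches_def)

lemma reaches_step: "f c = c' \<Longrightarrow> reaches f 1 c c'"
  by (rule reaches_funpow[of 1]) auto

lemma reaches_trans [trans]: "reaches f m a b \<Longrightarrow> reaches f n b c \<Longrightarrow> reaches f (m + n) a c"
  unfolding reaches_def by (metis add_le_mono comp_apply funpow_add add.commute)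

lemma reaches_mono: "reaches f m a b \<Longrightarrow> m \<le> n \<Longrightarrow> reaches f n a b"
  unfolding reaches_def using le_trans by blast

text \<open>The finite state set is injected into the natural numbers, and both machines run in
  lockstep. The invariant keeps state and tape inside \<open>S\<close> and \<open>A\<close>, where
  the injection can be undone and \<open>closed\<close> applies.\<close>

lemma class_P_machineI:
  fixes \<delta> :: "'s \<Rightarrow> 'a symbol \<Rightarrow> 's \<times> 'a symbol \<times> move"
  assumes "finite S" "finite A" "Blank \<in> A" "Letter ` \<Gamma> \<subseteq> A"
    and "start \<in> S" "yes \<in> S" "no \<in> S" "yes \<noteq> no"
    and closed: "\<And>s b. s \<in> S - {yes, no} \<Longrightarrow> b \<in> A \<Longrightarrow> \<delta> s b \<in> S \<times> A \<times> UNIV"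
    and "L \<subseteq> lists \<Gamma>"
    and run: "\<And>w. w \<in> lists \<Gamma> \<Longrightarrow> \<exists>tp h. reaches (machine_step \<delta> {yes, no}) (poly p (length w))
      (start, input_tape w, 0) (if w \<in> L then yes else no, tp, h)"
  shows "L \<in> class_P \<Gamma>"
proof -
  obtain e :: "'s \<Rightarrow> nat" where e: "inj_on e S"
    using finite_imp_inj_to_nat_seg[OF assms(1)] by blast
  define e' where "e' = the_inv_into S e"
  have e'e [simp]: "e' (e s) = s" if "s \<in> S" for s
    using the_inv_into_f_f[OF e that] by (simp add: e'_def)
  define M where "M = \<lparr>states = e ` S, symbols = A, start_state = e start, accept_state = e yes,
    reject_state = e no, delta = (\<lambda>q b. case \<delta> (e' q) b of (s, c, m) \<Rightarrow> (e s, c, m))\<rparr>"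
  have eq [simp]: "e s = e t \<longleftrightarrow> s = t" if "s \<in> S" "t \<in> S" for s t
    using e that by (auto simp: inj_on_def)
  have "turing_machine \<Gamma> M"
  proof -
    have "delta M (e s) b \<in> states M \<times> symbols M \<times> UNIV" if "s \<in> S - {yes, no}" "b \<in> A" for s b
      using closed[OF that] that by (auto simp: M_def split: prod.splits)
    then have "\<forall>q \<in> states M - {accept_state M, reject_state M}. \<forall>s \<in> symbols M.
        delta M q s \<in> states M \<times> symbols M \<times> UNIV"
      using assms(6,7) by (auto simp: M_def)
    then show ?thesis
      using assms(1-8) unfolding turing_machine_def by (auto simp: M_def)
  qed
  moreover have "decides_at M L w (poly p (length w))" if w: "w \<in> lists \<Gamma>" for w
  proof -
    let ?f = "machine_step \<delta> {yes, no}"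
    let ?c0 = "(start, input_tape w, 0)"
    have sim: "\<exists>s tp h. (?f ^^ t) ?c0 = (s, tp, h) \<and> s \<in> S \<and> range tp \<subseteq> A \<and>
        config_after M w t = (e s, tp, h)" for t
    proof (induction t)
      case 0
      have "range (input_tape w) \<subseteq> A" using assms(3,4) w
        by (auto simp: input_tape_def in_lists_conv_set image_subset_iff)
      then show ?case using assms(5)
        by (auto simp: config_after_def initial_config_def input_tape_def M_def)
    next
      case (Suc t)
      then obtain s tp h where c: "(?f ^^ t) ?c0 = (s, tp, h)" "s \<in> S" "range tp \<subseteq> A"
        "config_after M w t = (e s, tp, h)" by blast
      have 1: "(?f ^^ Suc t) ?c0 = ?f (s, tp, h)" using c(1) by simp
      have 2: "config_after M w (Suc t) = tm_step M (e s, tp, h)"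
        using c(4) by (simp add: config_after_def)
      show ?case
      proof (cases "s \<in> {yes, no}")
        case True
        then have "?f (s, tp, h) = (s, tp, h)" "tm_step M (e s, tp, h) = (e s, tp, h)"
          by (auto simp: machine_step_halted tm_step_def halted_def state_of_def M_def)
        then show ?thesis using 1 2 c by auto
      next
        case False
        obtain s' b m where d: "\<delta> s (tp h) = (s', b, m)" by (cases "\<delta> s (tp h)")
        have mem: "s' \<in> S" "b \<in> A" using closed[of s "tp h"] False c d by auto
        have "?f (s, tp, h) = (s', tp(h := b), move_head m h)"
          using False d by (simp add: machine_step_eq)
        moreover have "tm_step M (e s, tp, h) = (e s', tp(h := b), move_head m h)"
          using False d c assms(6,7)
          by (simp add: tm_step_def halted_def state_of_def tape_of_def head_of_def M_def)
        moreover have "range (tp(h := b)) \<subseteq> A" using c(3) mem by auto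
        ultimately show ?thesis using 1 2 mem by auto
      qed
    qed
    let ?v = "if w \<in> L then yes else no"
    obtain k tp h where k: "k \<le> poly p (length w)" "(?f ^^ k) ?c0 = (?v, tp, h)"
      using run[OF w] by (auto simp: reaches_def)
    \<comment> \<open>\<open>decides_at\<close> looks at an exact time; a halted run can be
      prolonged to it unchanged.\<close>
    have "(?f ^^ poly p (length w)) ?c0 = (?f ^^ (poly p (length w) - k)) ((?f ^^ k) ?c0)"
      using k(1) by (metis comp_apply funpow_add le_add_diff_inverse2)
    also have "\<dots> = (?v, tp, h)" unfolding k(2) by (intro funpow_machine_step_halted) auto
    finally have "config_after M w (poly p (length w)) = (e ?v, tp, h)"
      using sim[of "poly p (length w)"] by auto
    then show ?thesis using assms(6-8)
      by (auto simp: decides_at_def halted_def state_of_def M_def)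
  qed
  ultimately show ?thesis using assms(10) unfolding class_P_def by blast
qed

lemma poly_nat_mono: "x \<le> y \<Longrightarrow> poly p x \<le> poly (p :: nat poly) y"
  by (induction p) (auto intro!: add_mono mult_mono)

text \<open>After \<open>Start\<close> and \<open>Encode\<close> have translated the input, each round generates one token:
  \<open>Rewind\<close> and \<open>Seek\<close> go to cell 0, \<open>Run\<close> simulates the generator on a copy of the context, \<open>Back\<close>
  and \<open>Read\<close> fetch its output, \<open>Append\<close> writes it at the end of the context. \<open>Read\<close>, \<open>Append\<close> and
  \<open>Wipe\<close> restore the copy on the way.\<close>

datatype 'v phase = Start | Encode | Rewind | Seek | Run nat | Back | Read | Append 'v | Wipe | Yes | No

section \<open>The two-track machine\<close>

locale generator_machine =
  fixes V :: "'v set" and \<pi> :: "'v list \<Rightarrow> 'v" and M :: "'v tm" and p :: "nat poly"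
    and \<Gamma> :: "'g set" and enc :: "'g \<Rightarrow> 'v" and Acc Rej :: "'v set" and L :: "'g list set"
  assumes finite_V: "finite V" and finite_\<Gamma>: "finite \<Gamma>"
    and enc: "enc ` \<Gamma> \<subseteq> V"
    and M: "turing_machine V M"
    and \<pi>: "\<And>y. y \<in> lists V \<Longrightarrow> \<pi> y \<in> V"
    and halts: "\<And>y. y \<in> lists V \<Longrightarrow> halted M (config_after M y (poly p (length y)))"
    and out: "\<And>y. y \<in> lists V \<Longrightarrow> has_output (config_after M y (poly p (length y))) [\<pi> y]"
begin

text \<open>A cell that has been visited holds a pair: a token of the context, if there is one at this
  position, and a symbol of the simulated machine. A blank cell is one that has not been visited, so
  the visited cells form an interval whose ends can be found.\<close>

definition pairs :: "('v option \<times> 'v symbol) set" where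
  "pairs = ({None} \<union> Some ` V) \<times> symbols M"

definition pair_code :: "'v option \<times> 'v symbol \<Rightarrow> nat" where
  "pair_code = (SOME e. inj_on e pairs)"

text \<open>Apart from the blank, only the letters of the input alphabet and \<open>Aux\<close> are
  available as symbols, so a pair is numbered and becomes an \<open>Aux\<close>.\<close>

definition pack :: "'v option \<times> 'v symbol \<Rightarrow> 'g symbol" where
  "pack x = Aux (pair_code x)"

text \<open>A blank cell reads as an empty pair, so the simulated head can enter new cells without
  preparation.\<close>

fun view :: "'g symbol \<Rightarrow> 'v option \<times> 'v symbol" where
  "view (Aux c) = the_inv_into pairs pair_code c"
| "view _ = (None, Blank)"

text \<open>The answer for the empty word is built in as a constant, since the process settles only
  nonempty words. The test \<open>a \<in> V\<close> in \<open>Read\<close> keeps the phases within a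
  finite set, as \<open>symbols M\<close> may contain further letters.\<close>

fun control :: "'v phase \<Rightarrow> 'g symbol \<Rightarrow> 'v phase \<times> 'g symbol \<times> move" where
  "control Start b = (case b of
     Letter g \<Rightarrow> (Encode, pack (Some (enc g), Letter (enc g)), MoveRight)
   | _ \<Rightarrow> (if [] \<in> L then Yes else No, b, Stay))"
| "control Encode b = (case b of
     Letter g \<Rightarrow> (Encode, pack (Some (enc g), Letter (enc g)), MoveRight)
   | _ \<Rightarrow> (Rewind, b, MoveLeft))"
| "control Rewind b = (if b = Blank then (Seek, b, MoveRight) else (Rewind, b, MoveLeft))"
| "control Seek b =
     (if fst (view b) = None then (Seek, b, MoveRight) else (Run (start_state M), b, Stay))"
| "control (Run q) b =
     (if q = accept_state M \<or> q = reject_state M then (Back, pack (view b), Stay)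
      else case delta M q (snd (view b)) of (q', s', m) \<Rightarrow> (Run q', pack (fst (view b), s'), m))"
| "control Back b = (if b = Blank then (Read, b, MoveRight) else (Back, b, MoveLeft))"
| "control Read b = (case view b of
     (None, s) \<Rightarrow> (Read, pack (None, Blank), MoveRight)
   | (Some v, s) \<Rightarrow> (case s of
       Letter a \<Rightarrow> if a \<in> Acc then (Yes, b, Stay) else if a \<in> Rej then (No, b, Stay)
         else if a \<in> V then (Append a, pack (Some v, Letter v), MoveRight) else (No, b, Stay)
     | _ \<Rightarrow> (No, b, Stay)))"
| "control (Append a) b = (case view b of
     (Some v, s) \<Rightarrow> (Append a, pack (Some v, Letter v), MoveRight)
   | (None, s) \<Rightarrow> (Wipe, pack (Some a, Letter a), MoveRight))"
| "control Wipe b =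
     (if b = Blank then (Rewind, b, MoveLeft) else (Wipe, pack (None, Blank), MoveRight))"
| "control Yes b = (Yes, b, Stay)"
| "control No b = (No, b, Stay)"

definition phases :: "'v phase set" where
  "phases = {Start, Encode, Rewind, Seek, Back, Read, Wipe, Yes, No} \<union> Run ` states M \<union> Append ` V"

definition alphabet :: "'g symbol set" where
  "alphabet = {Blank} \<union> Letter ` \<Gamma> \<union> pack ` pairs"

lemma M_facts:
  "finite (states M)" "finite (symbols M)" "Blank \<in> symbols M" "v \<in> V \<Longrightarrow> Letter v \<in> symbols M"
  "start_state M \<in> states M"
  using M by (auto simp: turing_machine_def)

lemma finite_pairs: "finite pairs"
  using finite_V M_facts by (simp add: pairs_def)

lemma view_pack [simp]: "x \<in> pairs \<Longrightarrow> view (pack x) = x"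
proof -
  have "\<exists>e :: 'v option \<times> 'v symbol \<Rightarrow> nat. inj_on e pairs"
    using finite_imp_inj_to_nat_seg[OF finite_pairs] by blast
  then have "inj_on pair_code pairs" unfolding pair_code_def by (rule someI_ex)
  then show "x \<in> pairs \<Longrightarrow> view (pack x) = x" by (simp add: pack_def the_inv_into_f_f)
qed

lemma pack_simps [simp]: "pack x \<noteq> Blank" "pack x \<noteq> Letter g"
  by (simp_all add: pack_def)

lemma pairs_simps [simp]:
  "(None, s) \<in> pairs \<longleftrightarrow> s \<in> symbols M" "(Some v, s) \<in> pairs \<longleftrightarrow> v \<in> V \<and> s \<in> symbols M"
  by (auto simp: pairs_def)

lemma view_alphabet:
  assumes "b \<in> alphabet"
  shows "view b \<in> pairs"
  using assms M_facts by (auto simp: alphabet_def)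

lemma pack_alphabet [simp]: "x \<in> pairs \<Longrightarrow> pack x \<in> alphabet"
  by (simp add: alphabet_def)

lemma phases_simps [simp]:
  "Start \<in> phases" "Encode \<in> phases" "Rewind \<in> phases" "Seek \<in> phases" "Back \<in> phases"
  "Read \<in> phases" "Wipe \<in> phases" "Yes \<in> phases" "No \<in> phases"
  "Run q \<in> phases \<longleftrightarrow> q \<in> states M" "Append a \<in> phases \<longleftrightarrow> a \<in> V"
  by (auto simp: phases_def)

lemma control_closed:
  assumes "s \<in> phases - {Yes, No}" "b \<in> alphabet"
  shows "control s b \<in> phases \<times> alphabet \<times> UNIV"
proof -
  obtain o' c where v: "view b = (o', c)" "(o', c) \<in> pairs"
    using view_alphabet[OF assms(2)] by (cases "view b") auto
  have letter: "b = Letter g \<Longrightarrow> g \<in> \<Gamma>" for g using assms(2) by (auto simp: alphabet_def pack_def)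
  have enc': "g \<in> \<Gamma> \<Longrightarrow> enc g \<in> V" for g using enc by auto
  show ?thesis
  proof (cases s)
    case (Run q)
    have "delta M q c \<in> states M \<times> symbols M \<times> UNIV"
      if "q \<noteq> accept_state M" "q \<noteq> reject_state M"
      using M assms(1) that v(2) by (auto simp: turing_machine_def Run pairs_def)
    then show ?thesis using v Run by (cases o') (auto split: prod.splits)
  qed (use assms v letter enc' M_facts in \<open>auto split: symbol.splits option.splits prod.splits\<close>)
qed

section \<open>One generated token, phase by phase\<close>

definition tape :: "'v list \<Rightarrow> (int \<Rightarrow> 'v symbol) \<Rightarrow> int \<Rightarrow> int \<Rightarrow> int \<Rightarrow> 'g symbol" where
  "tape y t l r = (\<lambda>i. if l \<le> i \<and> i \<le> r
     then pack (if 0 \<le> i \<and> i < int (length y) then Some (y ! nat i) else None, t i) else Blank)"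

abbreviation step :: "'v phase \<times> (int \<Rightarrow> 'g symbol) \<times> int \<Rightarrow> 'v phase \<times> (int \<Rightarrow> 'g symbol) \<times> int" where
  "step \<equiv> machine_step control {Yes, No}"


text \<open>The second track at the beginning of a round.\<close>

definition clean :: "'v list \<Rightarrow> int \<Rightarrow> 'v symbol" where
  "clean y = tape_of (initial_config M y)"

lemma clean_eq: "clean y i = (if 0 \<le> i \<and> i < int (length y) then Letter (y ! nat i) else Blank)"
  by (simp add: clean_def initial_config_def tape_of_def)

text \<open>One \<open>W\<close> serves all rounds: every simulated run starts at cell 0 and makes
  at most \<open>W\<close> steps, so excursions of different rounds do not add up.\<close>

definition window :: "nat \<Rightarrow> 'v list \<Rightarrow> (int \<Rightarrow> 'v symbol) \<Rightarrow> int \<Rightarrow> int \<Rightarrow> bool" where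
  "window W y t l r \<longleftrightarrow> y \<in> lists V \<and> y \<noteq> [] \<and> range t \<subseteq> symbols M \<and>
     (\<forall>i. i < l \<or> r < i \<longrightarrow> t i = Blank) \<and>
     - int W \<le> l \<and> l \<le> 0 \<and> int (length y) - 1 \<le> r \<and> r \<le> int W"

lemma window_pair:
  assumes "window W y t l r"
  shows "(if 0 \<le> i \<and> i < int (length y) then Some (y ! nat i) else None, t i) \<in> pairs"
  using assms by (auto simp: window_def in_lists_conv_set)

lemma view_tape:
  assumes "window W y t l r"
  shows "view (tape y t l r i)
    = (if 0 \<le> i \<and> i < int (length y) then Some (y ! nat i) else None, t i)"
proof (cases "l \<le> i \<and> i \<le> r")
  case True
  then show ?thesis using window_pair[OF assms, of i] by (simp add: tape_def)
next
  case False
  then show ?thesis using assms by (auto simp: tape_def window_def)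
qed

lemma tape_eq_Blank: "tape y t l r i = Blank \<longleftrightarrow> i < l \<or> r < i"
  by (auto simp: tape_def)

text \<open>The head may be one cell outside the visited interval; writing there extends the
  interval.\<close>

lemma tape_upd:
  assumes "window W y t l r" "l - 1 \<le> i" "i \<le> r + 1"
  shows "(tape y t l r)(i := pack (fst (view (tape y t l r i)), s))
    = tape y (t(i := s)) (min l i) (max r i)"
  using assms(2,3) unfolding view_tape[OF assms(1)] by (auto simp: tape_def fun_eq_iff)

text \<open>Cell 0 needs no mark: coming from the blank at \<open>l - 1\<close>, it is the first
  cell with a context token, as \<open>y\<close> is nonempty.\<close>

lemma rewind_seek:
  assumes w: "window W y t l r" and h: "l - 1 \<le> h" "h \<le> r"
  shows "reaches step (4 * W + 4) (Rewind, tape y t l r, h) (Run (start_state M), tape y t l r, 0)"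
proof -
  let ?tp = "tape y t l r"
  have b: "- int W \<le> l" "l \<le> 0" "int (length y) - 1 \<le> r" "r \<le> int W" "0 < length y"
    using w by (auto simp: window_def)
  have "(step ^^ nat (h - (l - 1))) (Rewind, ?tp, h) = (Rewind, ?tp, h - int (nat (h - (l - 1))))"
    by (rule sweep_left) (use h in \<open>auto simp: tape_eq_Blank\<close>)
  then have "reaches step (2 * W + 1) (Rewind, ?tp, h) (Rewind, ?tp, l - 1)"
    using h b by (intro reaches_funpow) auto
  also have "reaches step 1 (Rewind, ?tp, l - 1) (Seek, ?tp, l)"
    by (rule reaches_step, subst machine_step_eq) (auto simp: tape_eq_Blank)
  also have "(step ^^ nat (- l)) (Seek, ?tp, l)
      = (Seek, \<lambda>i. if l \<le> i \<and> i < l + int (nat (- l)) then ?tp i else ?tp i, l + int (nat (- l)))"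
    by (rule sweep_right) (use b in \<open>auto simp: view_tape[OF w]\<close>)
  then have "reaches step W (Seek, ?tp, l) (Seek, ?tp, 0)"
    using b by (intro reaches_funpow) auto
  also have "reaches step 1 (Seek, ?tp, 0) (Run (start_state M), ?tp, 0)"
    by (rule reaches_step, subst machine_step_eq) (use b in \<open>auto simp: view_tape[OF w]\<close>)
  finally show ?thesis by (rule reaches_mono) simp
qed

lemma simulate_step:
  assumes w: "window W y t l r" and h: "l - 1 \<le> h" "h \<le> r + 1"
    and q: "q \<in> states M" "\<not> halted M (q, t, h)"
  shows "\<exists>q' t' h'. tm_step M (q, t, h) = (q', t', h') \<and> q' \<in> states M \<and>
    step (Run q, tape y t l r, h) = (Run q', tape y t' (min l h) (max r h), h') \<and>
    range t' \<subseteq> symbols M \<and> (\<forall>i. i < min l h \<or> max r h < i \<longrightarrow> t' i = Blank) \<and>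
    h - 1 \<le> h' \<and> h' \<le> h + 1"
proof -
  obtain q' s' m where d: "delta M q (t h) = (q', s', m)" by (cases "delta M q (t h)")
  have nh: "q \<noteq> accept_state M" "q \<noteq> reject_state M"
    using q(2) by (auto simp: halted_def state_of_def)
  have "t h \<in> symbols M" using w by (auto simp: window_def)
  then have "delta M q (t h) \<in> states M \<times> symbols M \<times> UNIV"
    using M q(1) nh by (auto simp: turing_machine_def)
  then have mem: "q' \<in> states M" "s' \<in> symbols M" using d by auto
  have "tm_step M (q, t, h) = (q', t(h := s'), move_head m h)"
    using q(2) d by (simp add: tm_step_def state_of_def tape_of_def head_of_def)
  moreover have "step (Run q, tape y t l r, h)
      = (Run q', tape y (t(h := s')) (min l h) (max r h), move_head m h)"
    using nh d tape_upd[OF w h, of s'] by (subst machine_step_eq) (auto simp: view_tape[OF w])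
  moreover have "h - 1 \<le> move_head m h" "move_head m h \<le> h + 1" by (cases m; simp)+
  moreover have "range (t(h := s')) \<subseteq> symbols M" using w mem by (auto simp: window_def)
  moreover have "\<forall>i. i < min l h \<or> max r h < i \<longrightarrow> (t(h := s')) i = Blank"
    using w by (auto simp: window_def)
  ultimately show ?thesis using mem by blast
qed

text \<open>The head is at distance at most \<open>k\<close> from cell 0 after \<open>k\<close>
  steps, which keeps the growing interval within \<open>W\<close>.\<close>

lemma simulate:
  assumes w: "window W y (clean y) l r" and k: "k \<le> W"
    and nh: "\<And>j. j < k \<Longrightarrow> \<not> halted M (config_after M y j)"
  shows "\<exists>q t h l' r'. config_after M y k = (q, t, h) \<and> q \<in> states M \<and>
    (step ^^ k) (Run (start_state M), tape y (clean y) l r, 0) = (Run q, tape y t l' r', h) \<and>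
    window W y t l' r' \<and> l' - 1 \<le> h \<and> h \<le> r' + 1 \<and> - int k \<le> h \<and> h \<le> int k"
  using k nh
proof (induction k)
  case 0
  have "config_after M y 0 = (start_state M, clean y, 0)"
    by (simp add: config_after_def clean_def initial_config_def tape_of_def)
  moreover have "l - 1 \<le> 0" "0 \<le> r + 1" using w by (auto simp: window_def)
  ultimately show ?case using w M_facts by auto
next
  case (Suc k)
  then obtain q t h l' r' where IH: "config_after M y k = (q, t, h)" "q \<in> states M"
    "(step ^^ k) (Run (start_state M), tape y (clean y) l r, 0) = (Run q, tape y t l' r', h)"
    "window W y t l' r'" "l' - 1 \<le> h" "h \<le> r' + 1" "- int k \<le> h" "h \<le> int k"
    by auto
  have "\<not> halted M (q, t, h)" using Suc.prems(2)[of k] IH(1) by simp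
  from simulate_step[OF IH(4-6,2) this] obtain q' t' h' where 1:
    "tm_step M (q, t, h) = (q', t', h')" "q' \<in> states M"
    "step (Run q, tape y t l' r', h) = (Run q', tape y t' (min l' h) (max r' h), h')"
    "range t' \<subseteq> symbols M" "\<forall>i. i < min l' h \<or> max r' h < i \<longrightarrow> t' i = Blank"
    "h - 1 \<le> h'" "h' \<le> h + 1" by blast
  have "window W y t' (min l' h) (max r' h)"
    using IH(4,7,8) 1(4,5) Suc.prems(1) by (auto simp: window_def)
  moreover have "config_after M y (Suc k) = (q', t', h')"
    using IH(1) 1(1) by (simp add: config_after_def)
  moreover have "(step ^^ Suc k) (Run (start_state M), tape y (clean y) l r, 0)
      = (Run q', tape y t' (min l' h) (max r' h), h')"
    using IH(3) 1(3) by simp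
  moreover have "min l' h - 1 \<le> h'" "h' \<le> max r' h + 1" "- int (Suc k) \<le> h'" "h' \<le> int (Suc k)"
    using 1(6,7) IH(7,8) by auto
  ultimately show ?case using 1(2) by blast
qed

lemma simulate_run:
  assumes w: "window W y (clean y) l r" and W: "poly p (length y) \<le> W"
  shows "\<exists>t l' r' h. window W y t l' r' \<and> t 0 = Letter (\<pi> y) \<and> l' \<le> h \<and> h \<le> r' \<and>
    reaches step (W + 1) (Run (start_state M), tape y (clean y) l r, 0) (Back, tape y t l' r', h)"
proof -
  have y: "y \<in> lists V" using w by (simp add: window_def)
  define T where "T = (LEAST k. halted M (config_after M y k))"
  have T: "halted M (config_after M y T)" unfolding T_def using halts[OF y] by (rule LeastI)
  have T_le: "T \<le> poly p (length y)" unfolding T_def using halts[OF y] by (rule Least_le)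
  have nh: "\<not> halted M (config_after M y j)" if "j < T" for j
    using that not_less_Least unfolding T_def by blast
  obtain q t h l' r' where 1: "config_after M y T = (q, t, h)" "q \<in> states M"
    "(step ^^ T) (Run (start_state M), tape y (clean y) l r, 0) = (Run q, tape y t l' r', h)"
    "window W y t l' r'" "l' - 1 \<le> h" "h \<le> r' + 1" "- int T \<le> h" "h \<le> int T"
    using simulate[OF w, of T] T_le W nh by auto
  have q: "q = accept_state M \<or> q = reject_state M"
    using T 1(1) by (auto simp: halted_def state_of_def)
  have "has_output (q, t, h) [\<pi> y]"
    using out[OF y] config_after_halted[OF T T_le] 1(1) by simp
  then have out: "t 0 = Letter (\<pi> y)" by (simp add: has_output_def tape_of_def)
  have win: "window W y t (min l' h) (max r' h)"
    using 1(4,7,8) T_le W by (auto simp: window_def)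
  have "reaches step W (Run (start_state M), tape y (clean y) l r, 0) (Run q, tape y t l' r', h)"
    using reaches_funpow[OF 1(3)] T_le W by simp
  \<comment> \<open>The halting step packs the cell under the head. Otherwise the head could rest on
    a blank just right of the interval, which \<open>Back\<close> would take for the left
    end.\<close>
  also have "step (Run q, tape y t l' r', h) = (Back, tape y t (min l' h) (max r' h), h)"
    using q tape_upd[OF 1(4-6), of "t h"] by (subst machine_step_eq) (auto simp: view_tape[OF 1(4)])
  then have "reaches step 1 (Run q, tape y t l' r', h) (Back, tape y t (min l' h) (max r' h), h)"
    by (rule reaches_step)
  finally show ?thesis using win out by (intro exI conjI) auto
qed

lemma read_result:
  assumes w: "window W y t l r" and h: "l \<le> h" "h \<le> r"
  shows "\<exists>tp. reaches step (3 * W + 2) (Back, tape y t l r, h) (Read, tp, 0) \<and>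
    tp = (\<lambda>i. if l \<le> i \<and> i < 0 then pack (None, Blank) else tape y t l r i)"
proof -
  let ?tp = "tape y t l r"
  have b: "- int W \<le> l" "l \<le> 0" "int (length y) - 1 \<le> r" "r \<le> int W" "0 < length y"
    using w by (auto simp: window_def)
  have "(step ^^ nat (h - (l - 1))) (Back, ?tp, h) = (Back, ?tp, h - int (nat (h - (l - 1))))"
    by (rule sweep_left) (use h in \<open>auto simp: tape_eq_Blank\<close>)
  then have "reaches step (2 * W + 1) (Back, ?tp, h) (Back, ?tp, l - 1)"
    using h b by (intro reaches_funpow) auto
  also have "reaches step 1 (Back, ?tp, l - 1) (Read, ?tp, l)"
    by (rule reaches_step, subst machine_step_eq) (auto simp: tape_eq_Blank)
  also have "(step ^^ nat (- l)) (Read, ?tp, l)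
      = (Read, \<lambda>i. if l \<le> i \<and> i < l + int (nat (- l)) then pack (None, Blank) else ?tp i,
         l + int (nat (- l)))"
    by (rule sweep_right) (use b in \<open>auto simp: view_tape[OF w]\<close>)
  then have "reaches step W (Read, ?tp, l)
      (Read, \<lambda>i. if l \<le> i \<and> i < 0 then pack (None, Blank) else ?tp i, 0)"
    using b by (intro reaches_funpow) auto
  finally show ?thesis by (intro exI conjI, rule reaches_mono) auto
qed

text \<open>\<open>tp\<close> is the tape left by \<open>Read\<close>, already cleaned left of cell
  0. \<open>tp1\<close> and \<open>tp2\<close> restore the second track along the context,
  \<open>tp3\<close> adds the new token on both tracks, and \<open>tp4\<close> clears what lies to
  the right. Cell \<open>length y\<close> may be new, hence the maximum in
  \<open>r'\<close>.\<close>

lemma append_result: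
  assumes w: "window W y t l r" and a: "a \<in> V" "a \<notin> Acc" "a \<notin> Rej" and t0: "t 0 = Letter a"
    and W: "length y \<le> W"
  defines "tp \<equiv> \<lambda>i. if l \<le> i \<and> i < 0 then pack (None, Blank) else tape y t l r i"
    and "r' \<equiv> max r (int (length y))"
  shows "reaches step (2 * W + 3) (Read, tp, 0) (Rewind, tape (y @ [a]) (clean (y @ [a])) l r', r')"
    and "window W (y @ [a]) (clean (y @ [a])) l r'"
proof -
  let ?n = "int (length y)"
  have b: "- int W \<le> l" "l \<le> 0" "?n - 1 \<le> r" "r \<le> int W" "0 < length y" "y \<in> lists V"
    using w by (auto simp: window_def)
  have yV: "y ! i \<in> V" if "i < length y" for i using b(6) that by (auto simp: in_lists_conv_set)
  have view: "view (tp i) = (if 0 \<le> i \<and> i < ?n then Some (y ! nat i) else None, t i)" if "0 \<le> i" for i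
    using that view_tape[OF w, of i] by (simp add: tp_def)
  let ?cp = "\<lambda>i. pack (Some (y ! nat i), Letter (y ! nat i))"
  define tp1 where "tp1 = tp(0 := ?cp 0)"
  define tp2 where "tp2 = (\<lambda>i. if 1 \<le> i \<and> i < ?n then ?cp i else tp1 i)"
  define tp3 where "tp3 = tp2(?n := pack (Some a, Letter a))"
  define tp4 where "tp4 = (\<lambda>i. if ?n + 1 \<le> i \<and> i < r' + 1 then pack (None, Blank) else tp3 i)"
  have "reaches step 1 (Read, tp, 0) (Append a, tp1, 1)"
    using a view[of 0] t0 b
    by (intro reaches_step, subst machine_step_eq) (auto simp: tp1_def)
  also have "(step ^^ (length y - 1)) (Append a, tp1, 1)
      = (Append a, \<lambda>i. if 1 \<le> i \<and> i < 1 + int (length y - 1) then ?cp i else tp1 i, 1 + int (length y - 1))"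
    by (rule sweep_right) (use view b in \<open>auto simp: tp1_def\<close>)
  then have "reaches step W (Append a, tp1, 1) (Append a, tp2, ?n)"
    using b W by (intro reaches_funpow[of "length y - 1"]) (auto simp: tp2_def of_nat_diff)
  also have "reaches step 1 (Append a, tp2, ?n) (Wipe, tp3, ?n + 1)"
    using view[of ?n] b
    by (intro reaches_step, subst machine_step_eq) (auto simp: tp1_def tp2_def tp3_def)
  also have "(step ^^ nat (r' - ?n)) (Wipe, tp3, ?n + 1)
      = (Wipe, \<lambda>i. if ?n + 1 \<le> i \<and> i < ?n + 1 + int (nat (r' - ?n)) then pack (None, Blank) else tp3 i,
         ?n + 1 + int (nat (r' - ?n)))"
    by (rule sweep_right)
      (use b in \<open>auto simp: tp1_def tp2_def tp3_def tp_def r'_def tape_eq_Blank\<close>)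
  then have "reaches step W (Wipe, tp3, ?n + 1) (Wipe, tp4, r' + 1)"
    using b W by (intro reaches_funpow[of "nat (r' - ?n)"]) (auto simp: tp4_def r'_def)
  also have "tp4 (r' + 1) = Blank"
  proof -
    have "?n \<le> r'" "r \<le> r'" by (auto simp: r'_def)
    then show ?thesis
      using b by (simp add: tp1_def tp2_def tp3_def tp4_def tp_def tape_eq_Blank)
  qed
  then have "reaches step 1 (Wipe, tp4, r' + 1) (Rewind, tp4, r')"
    by (intro reaches_step, subst machine_step_eq) auto
  finally have R: "reaches step (2 * W + 3) (Read, tp, 0) (Rewind, tp4, r')"
    by (rule reaches_mono) simp
  have "tp4 = tape (y @ [a]) (clean (y @ [a])) l r'"
  proof
    fix i
    consider "i < l" | "l \<le> i" "i < 0" | "i = 0" | "1 \<le> i" "i < ?n" | "i = ?n" | "?n < i" "i \<le> r'" | "r' < i"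
      by linarith
    then show "tp4 i = tape (y @ [a]) (clean (y @ [a])) l r' i"
      by cases (use b in \<open>auto simp: tp1_def tp2_def tp3_def tp4_def tp_def r'_def tape_def clean_eq nth_append\<close>)
  qed
  then show "reaches step (2 * W + 3) (Read, tp, 0) (Rewind, tape (y @ [a]) (clean (y @ [a])) l r', r')"
    using R by simp
  show "window W (y @ [a]) (clean (y @ [a])) l r'"
    using b a W M_facts by (auto simp: window_def clean_eq r'_def nth_append in_lists_conv_set)
qed

lemma generate_token:
  assumes w: "window W y (clean y) l r" and W: "poly p (length y) \<le> W" "length y \<le> W"
  shows "\<pi> y \<in> Acc \<union> Rej \<Longrightarrow> \<exists>tp. reaches step (10 * W + 10)
      (Rewind, tape y (clean y) l r, r) (if \<pi> y \<in> Acc then Yes else No, tp, 0)"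
    and "\<pi> y \<notin> Acc \<union> Rej \<Longrightarrow> \<exists>l' r'. window W (y @ [\<pi> y]) (clean (y @ [\<pi> y])) l' r' \<and>
      reaches step (10 * W + 10) (Rewind, tape y (clean y) l r, r)
        (Rewind, tape (y @ [\<pi> y]) (clean (y @ [\<pi> y])) l' r', r')"
proof -
  have y: "y \<in> lists V" "0 < length y" "l - 1 \<le> r" using w by (auto simp: window_def)
  obtain t l' r' h where 1: "window W y t l' r'" "t 0 = Letter (\<pi> y)" "l' \<le> h" "h \<le> r'"
    "reaches step (W + 1) (Run (start_state M), tape y (clean y) l r, 0) (Back, tape y t l' r', h)"
    using simulate_run[OF w W(1)] by blast
  define tp where "tp = (\<lambda>i. if l' \<le> i \<and> i < 0 then pack (None, Blank) else tape y t l' r' i)"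
  have "reaches step (4 * W + 4) (Rewind, tape y (clean y) l r, r)
      (Run (start_state M), tape y (clean y) l r, 0)" using rewind_seek[OF w y(3)] by simp
  also note 1(5)
  also have "reaches step (3 * W + 2) (Back, tape y t l' r', h) (Read, tp, 0)"
    using read_result[OF 1(1,3,4)] by (simp add: tp_def)
  \<comment> \<open>The phases cost \<open>4 * W + 4\<close>, \<open>W + 1\<close> and
    \<open>3 * W + 2\<close>; the \<open>2 * W + 3\<close> for appending then completes
    \<open>10 * W + 10\<close>.\<close>
  finally have R: "reaches step (8 * W + 7) (Rewind, tape y (clean y) l r, r) (Read, tp, 0)"
    by (rule reaches_mono) simp
  have view: "view (tp 0) = (Some (y ! 0), Letter (\<pi> y))"
    using view_tape[OF 1(1), of 0] 1(2) y(2) by (simp add: tp_def)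
  show "\<exists>tp. reaches step (10 * W + 10) (Rewind, tape y (clean y) l r, r)
      (if \<pi> y \<in> Acc then Yes else No, tp, 0)" if halt: "\<pi> y \<in> Acc \<union> Rej"
  proof -
    have "step (Read, tp, 0) = (if \<pi> y \<in> Acc then Yes else No, tp(0 := tp 0), move_head Stay 0)"
      using halt view by (intro machine_step_eq) auto
    then have "reaches step 1 (Read, tp, 0) (if \<pi> y \<in> Acc then Yes else No, tp, 0)"
      by (intro reaches_step) simp
    note R' = reaches_trans[OF R this]
    show ?thesis by (rule exI, rule reaches_mono[OF R']) simp
  qed
  assume no: "\<pi> y \<notin> Acc \<union> Rej"
  have "\<pi> y \<in> V" using \<pi>[OF y(1)] .
  note A = append_result[OF 1(1) this _ _ 1(2) W(2), folded tp_def]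
  show "\<exists>l' r'. window W (y @ [\<pi> y]) (clean (y @ [\<pi> y])) l' r' \<and>
      reaches step (10 * W + 10) (Rewind, tape y (clean y) l r, r)
        (Rewind, tape (y @ [\<pi> y]) (clean (y @ [\<pi> y])) l' r', r')"
  proof (intro exI conjI)
    show "window W (y @ [\<pi> y]) (clean (y @ [\<pi> y])) l' (max r' (int (length y)))"
      using A(2) no by blast
    show "reaches step (10 * W + 10) (Rewind, tape y (clean y) l r, r)
        (Rewind, tape (y @ [\<pi> y]) (clean (y @ [\<pi> y])) l' (max r' (int (length y))), max r' (int (length y)))"
      by (rule reaches_mono[OF reaches_trans[OF R A(1)]]) (use no in auto)
  qed
qed

section \<open>Complete runs and the time bound\<close>

lemma encode_input:
  assumes w: "w \<in> lists \<Gamma>" "w \<noteq> []" and W: "length w \<le> W"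
  defines "y \<equiv> map enc w"
  shows "reaches step (W + 1) (Start, input_tape w, 0)
      (Rewind, tape y (clean y) 0 (int (length y) - 1), int (length y) - 1)"
    and "window W y (clean y) 0 (int (length y) - 1)"
proof -
  let ?n = "int (length w)"
  have n: "0 < length w" using w by simp
  let ?cp = "\<lambda>i. pack (Some (enc (w ! nat i)), Letter (enc (w ! nat i)))"
  define tp1 where "tp1 = (input_tape w)(0 := ?cp 0)"
  have "(step ^^ (length w - 1)) (Encode, tp1, 1) = (Encode,
      \<lambda>i. if 1 \<le> i \<and> i < 1 + int (length w - 1) then ?cp i else tp1 i, 1 + int (length w - 1))"
    by (rule sweep_right) (auto simp: tp1_def input_tape_def)
  also have "(\<lambda>i. if 1 \<le> i \<and> i < 1 + int (length w - 1) then ?cp i else tp1 i)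
      = tape y (clean y) 0 (?n - 1)"
    using n by (auto simp: fun_eq_iff tp1_def input_tape_def tape_def clean_eq y_def of_nat_diff)
  also have "1 + int (length w - 1) = ?n" using n by linarith
  finally have sweep: "reaches step (length w - 1) (Encode, tp1, 1)
      (Encode, tape y (clean y) 0 (?n - 1), ?n)"
    by (rule reaches_funpow) simp
  have "reaches step 1 (Start, input_tape w, 0) (Encode, tp1, 1)"
    using n by (intro reaches_step, subst machine_step_eq) (auto simp: tp1_def input_tape_def)
  also note sweep
  also have "reaches step 1 (Encode, tape y (clean y) 0 (?n - 1), ?n)
      (Rewind, tape y (clean y) 0 (?n - 1), ?n - 1)"
    by (intro reaches_step, subst machine_step_eq) (auto simp: tape_def)
  finally show "reaches step (W + 1) (Start, input_tape w, 0)
      (Rewind, tape y (clean y) 0 (int (length y) - 1), int (length y) - 1)"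
    unfolding y_def length_map by (rule reaches_mono) (use n W in simp)
  have "enc g \<in> V" if "g \<in> set w" for g using that w enc by auto
  then show "window W y (clean y) 0 (int (length y) - 1)"
    using n W w M_facts by (auto simp: window_def clean_eq y_def)
qed

lemma run_generation:
  assumes w: "w \<in> lists \<Gamma>" "w \<noteq> []"
    and J: "halts_at Acc Rej id \<pi> (map enc w) J"
    and len: "length w + J \<le> N" and W: "poly p N \<le> W" "N \<le> W"
  shows "\<exists>tp h. reaches step (W + 1 + (J + 1) * (10 * W + 10)) (Start, input_tape w, 0)
    (if \<pi> (context_seq id \<pi> (map enc w) J) \<in> Acc then Yes else No, tp, h)"
proof -
  let ?y = "context_seq id \<pi> (map enc w)"
  have y_Suc: "?y (Suc j) = ?y j @ [\<pi> (?y j)]" for j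
    by (simp add: context_seq_def append_next_def)
  have length_y: "length (?y j) = length w + j" for j
    by (induction j) (simp_all add: context_seq_def append_next_def)
  have pW: "poly p (length (?y j)) \<le> W" "length (?y j) \<le> W" if "j \<le> J" for j
    using poly_nat_mono[of "length (?y j)" N p] len that W by (auto simp: length_y)
  have "\<exists>l r. window W (?y j) (clean (?y j)) l r \<and>
      reaches step (W + 1 + j * (10 * W + 10)) (Start, input_tape w, 0)
        (Rewind, tape (?y j) (clean (?y j)) l r, r)" if "j \<le> J" for j
    using that
  proof (induction j)
    case 0
    show ?case using encode_input[OF w, of W] len W(2) by (auto simp: context_seq_def)
  next
    case (Suc j)
    then obtain l r where 1: "window W (?y j) (clean (?y j)) l r"
      "reaches step (W + 1 + j * (10 * W + 10)) (Start, input_tape w, 0)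
        (Rewind, tape (?y j) (clean (?y j)) l r, r)" using Suc_leD by blast
    have "\<pi> (?y j) \<notin> Acc \<union> Rej" using J Suc.prems by (auto simp: halts_at_def)
    from generate_token(2)[OF 1(1) pW this] Suc.prems obtain l' r' where
      2: "window W (?y (Suc j)) (clean (?y (Suc j))) l' r'"
      "reaches step (10 * W + 10) (Rewind, tape (?y j) (clean (?y j)) l r, r)
        (Rewind, tape (?y (Suc j)) (clean (?y (Suc j))) l' r', r')"
      unfolding y_Suc by auto
    have "reaches step (W + 1 + Suc j * (10 * W + 10)) (Start, input_tape w, 0)
        (Rewind, tape (?y (Suc j)) (clean (?y (Suc j))) l' r', r')"
      by (rule reaches_mono[OF reaches_trans[OF 1(2) 2(2)]]) simp
    with 2(1) show ?case by blast
  qed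
  from this[of J] obtain l r where 1: "window W (?y J) (clean (?y J)) l r"
      "reaches step (W + 1 + J * (10 * W + 10)) (Start, input_tape w, 0)
        (Rewind, tape (?y J) (clean (?y J)) l r, r)" by auto
  have "\<pi> (?y J) \<in> Acc \<union> Rej" using J by (auto simp: halts_at_def)
  from generate_token(1)[OF 1(1) pW this] obtain tp where
    "reaches step (10 * W + 10) (Rewind, tape (?y J) (clean (?y J)) l r, r)
      (if \<pi> (?y J) \<in> Acc then Yes else No, tp, 0)" by blast
  note R = reaches_trans[OF 1(2) this]
  show ?thesis by (rule exI, rule exI, rule reaches_mono[OF R]) simp
qed

lemma class_P:
  assumes L: "L \<subseteq> lists \<Gamma>" and dec: "process_decides \<Gamma> Acc Rej enc id \<pi> L"
    and bound: "poly_bounded_context \<Gamma> Acc Rej enc id \<pi>"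
  shows "L \<in> class_P \<Gamma>"
proof -
  obtain q :: "nat poly" where q: "\<And>w J. w \<in> lists \<Gamma> \<Longrightarrow> w \<noteq> [] \<Longrightarrow>
      halts_at Acc Rej id \<pi> (map enc w) J \<Longrightarrow>
      max_context_length id \<pi> (map enc w) J \<le> poly q (length w)"
    using bound unfolding poly_bounded_context_def by blast
  \<comment> \<open>\<open>q\<close> bounds the context length and \<open>pcompose p q\<close> the
    running time of the generator on such a context; their sum bounds both. As \<open>J + 1\<close>
    tokens are generated and the context holds them all, \<open>q\<close> also bounds the number of
    rounds in \<open>P\<close>.\<close>
  define W where "W = q + pcompose p q"
  define P where "P = W + 1 + (q + 1) * ([:10:] * W + [:10:])"
  have "\<exists>tp h. reaches step (poly P (length w)) (Start, input_tape w, 0) (if w \<in> L then Yes else No, tp, h)"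
    if w: "w \<in> lists \<Gamma>" for w
  proof (cases "w = []")
    case True
    have "reaches step 1 (Start, input_tape w, 0) (if w \<in> L then Yes else No, input_tape w, 0)"
      by (intro reaches_step, subst machine_step_eq) (auto simp: True input_tape_def)
    then have "reaches step (poly P (length w)) (Start, input_tape w, 0) (if w \<in> L then Yes else No, input_tape w, 0)"
      by (rule reaches_mono) (simp add: P_def)
    then show ?thesis by blast
  next
    case False
    obtain J where J: "halts_at Acc Rej id \<pi> (map enc w) J"
      "\<pi> (context_seq id \<pi> (map enc w) J) \<in> Acc \<longleftrightarrow> w \<in> L"
      using dec w False unfolding process_decides_def by blast
    let ?n = "poly q (length w)"
    have length_y: "length (context_seq id \<pi> (map enc w) j) = length w + j" for j
      by (induction j) (simp_all add: context_seq_def append_next_def)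
    have "length (append_next \<pi> (context_seq id \<pi> (map enc w) J)) \<le> max_context_length id \<pi> (map enc w) J"
      unfolding max_context_length_def by (intro Max_ge) auto
    then have n: "length w + J + 1 \<le> ?n"
      using q[OF w False J(1)] by (simp add: append_next_def length_y)
    have W: "poly W (length w) = ?n + poly p ?n" by (simp add: W_def poly_pcompose)
    obtain tp h where R: "reaches step (poly W (length w) + 1 + (J + 1) * (10 * poly W (length w) + 10))
        (Start, input_tape w, 0) (if \<pi> (context_seq id \<pi> (map enc w) J) \<in> Acc then Yes else No, tp, h)"
      using run_generation[OF w False J(1), of ?n "poly W (length w)"] n W by auto
    have "poly W (length w) + 1 + (J + 1) * (10 * poly W (length w) + 10) \<le> poly P (length w)"
      using n by (auto simp: P_def intro!: mult_le_mono1)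
    from reaches_mono[OF R this] show ?thesis unfolding J(2) by blast
  qed
  moreover have "finite phases" "finite alphabet"
    using finite_V finite_\<Gamma> finite_pairs M_facts by (auto simp: phases_def alphabet_def)
  ultimately show ?thesis
    using control_closed L
    by (intro class_P_machineI[where S = phases and A = alphabet and \<delta> = control and start = Start
          and yes = Yes and no = No and p = P]) (auto simp: alphabet_def)
qed

end

lemma cot_class_P:
  assumes "finite \<Gamma>" "L \<subseteq> lists \<Gamma>" "vocabulary \<Gamma> V Acc Rej enc" "polytime_generator V \<pi>"
    and "process_decides \<Gamma> Acc Rej enc id \<pi> L" "poly_bounded_context \<Gamma> Acc Rej enc id \<pi>"
  shows "L \<in> class_P \<Gamma>"
proof -
  obtain M p where "turing_machine V M"
    "\<forall>x \<in> lists V. halted M (config_after M x (poly p (length x))) \<and>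
       has_output (config_after M x (poly p (length x))) [\<pi> x]"
    using assms(4) unfolding polytime_generator_def polytime_computable_def by blast
  then interpret generator_machine V \<pi> M p \<Gamma> enc Acc Rej L
    using assms(1,3,4) by unfold_locales (auto simp: vocabulary_def polytime_generator_def)
  show ?thesis using class_P assms by blast
qed

theorem corollary5p2:
  fixes \<Gamma> :: "'g set" and L :: "'g list set"
  assumes "finite \<Gamma>" and "L \<subseteq> lists \<Gamma>"
  shows
    "(L \<in> class_PSPACE \<Gamma> \<longrightarrow>
        (\<exists>(V :: nat set) Acc Rej enc sep ret (\<theta> :: nat transformer).
           pencil_vocabulary \<Gamma> V Acc Rej enc sep ret \<and>
           is_transformer V \<theta> \<and>
           well_defined_on_runs \<Gamma> V Acc Rej enc (pencil_reduce sep ret) \<theta> \<and>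
           process_decides \<Gamma> Acc Rej enc (pencil_reduce sep ret) (next_token V \<theta>) L \<and>
           poly_bounded_context \<Gamma> Acc Rej enc (pencil_reduce sep ret) (next_token V \<theta>)))
     \<and> (\<forall>(V :: 'v set) Acc Rej enc \<pi>.
           vocabulary \<Gamma> V Acc Rej enc \<and>
           polytime_generator V \<pi> \<and>
           process_decides \<Gamma> Acc Rej enc id \<pi> L \<and>
           poly_bounded_context \<Gamma> Acc Rej enc id \<pi>
           \<longrightarrow> L \<in> class_P \<Gamma>)"
  using pspace_pencil[OF assms(1)] cot_class_P[OF assms] by blast

end
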